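(* Let $X=(X_t)_{t\ge 0}$ be a one-dimensional time homogeneous Lévy process with Gaussian coefficient $\sigma$, Lévy measure $n(dy)$ and local time $L_t^a$. Suppose $\sigma\neq 0$ and $$\int_{\mathbb R\setminus\{0\}}\bigl(|y|^{3/2}\wedge 1\bigr)\,n(dy)<\infty .$$ Then for any $t\ge 0$ and any $p>2$, the local time $a\mapsto L_t^a$ is of bounded $p$-variation almost surely, i.e. $$\sup_{D(-\infty,\infty)}\sum_{i}\bigl|L_t^{a_{i+1}}-L_t^{a_i}\bigr|^p<\infty\quad\text{a.s.},$$ where the supremum is taken over all finite partitions $D(-\infty,\infty)=\{-\infty<a_0<a_1<\cdots<a_n<\infty\}$ of $\mathbb R$.
   Context: The process $X$ has the Lévy–Itô decomposition $$X_t=X_0+\sigma B_t+bt+\int_0^{t+}\!\!\int_{\mathbb R\setminus\{0\}}y\,1_{\{|y|\ge 1\}}N(ds\,dy)+\int_0^{t+}\!\!\int_{\mathbb R\setminus\{0\}}y\,1_{\{|y|<1\}}\tilde N(ds\,dy),$$ where $\sigma,b\in\mathbb R$, $B$ is a standard Brownian motion, $N$ is a Poisson random measure (independent of $B$) on $[0,\infty)\times(\mathbb R\setminus\{0\})$ with compensator $ds\,n(dy)$, $n$ is the Lévy measure, and $\tilde N(ds\,dy)=N(ds\,dy)-ds\,n(dy)$. The local time $L_t^x$ is defined by the occupation times formula $\int_0^t g(X_s)\,d[X,X]^c_s=\int_{-\infty}^\infty g(x)L_t^x\,dx$ for all nonnegative Borel $g$, where $[X,X]^c_s=\sigma^2 s$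 is the continuous part of the quadratic variation; the version continuous in $x$ is used. *)

theory Defs
  imports "HOL-Probability.Probability"
begin

text \<open>
  Processes are functions \<open>real \<Rightarrow> 'a \<Rightarrow> real\<close> of which only the times \<open>t \<ge> 0\<close> matter.
\<close>

definition (in prob_space) independent_increments :: "(real \<Rightarrow> 'a \<Rightarrow> real) \<Rightarrow> bool" where
  "independent_increments X \<longleftrightarrow>
     (\<forall>(m::nat) s. 0 \<le> s 0 \<and> strict_mono_on {..m} s \<longrightarrow>
        indep_vars (\<lambda>_. borel) (\<lambda>i \<omega>. X (s (Suc i)) \<omega> - X (s i) \<omega>) {..<m})"

definition cadlag :: "(real \<Rightarrow> real) \<Rightarrow> bool" where
  "cadlag f \<longleftrightarrow>
     (\<forall>t\<ge>0. (f \<longlongrightarrow> f t) (at_right t)) \<and> (\<forall>t>0. \<exists>l. (f \<longlongrightarrow> l) (at_left t))"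

text \<open>The initial value \<open>X 0\<close> is an arbitrary random variable.\<close>

locale levy_process = prob_space M for M :: "'a measure" +
  fixes X :: "real \<Rightarrow> 'a \<Rightarrow> real"
  assumes random_variable_X: "0 \<le> t \<Longrightarrow> random_variable borel (X t)"
    and increments_indep: "independent_increments X"
    and increments_stationary: "0 \<le> s \<Longrightarrow> 0 \<le> h \<Longrightarrow>
          distr M borel (\<lambda>\<omega>. X (s + h) \<omega> - X s \<omega>) = distr M borel (\<lambda>\<omega>. X h \<omega> - X 0 \<omega>)"
    and stochastically_continuous: "0 \<le> t \<Longrightarrow> 0 < \<epsilon> \<Longrightarrow>
          ((\<lambda>s. prob {\<omega> \<in> space M. \<epsilon> < \<bar>X s \<omega> - X t \<omega>\<bar>}) \<longlongrightarrow> 0) (at t within {0..})"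
    and cadlag_paths: "AE \<omega> in M. cadlag (\<lambda>s. X s \<omega>)"

locale brownian_motion = prob_space M for M :: "'a measure" +
  fixes B :: "real \<Rightarrow> 'a \<Rightarrow> real"
  assumes random_variable_B: "0 \<le> t \<Longrightarrow> random_variable borel (B t)"
    and B_0: "AE \<omega> in M. B 0 \<omega> = 0"
    and B_increments_indep: "independent_increments B"
    and B_increments_normal: "0 \<le> s \<Longrightarrow> s < t \<Longrightarrow>
          distributed M lborel (\<lambda>\<omega>. B t \<omega> - B s \<omega>) (normal_density 0 (sqrt (t - s)))"
    and B_continuous_paths: "AE \<omega> in M. continuous_on {0..} (\<lambda>s. B s \<omega>)"

locale poisson_random_measure = prob_space M for M :: "'a measure" +
  fixes \<mu> :: "'b measure" and N :: "'a \<Rightarrow> 'b measure"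
  assumes sets_N: "\<omega> \<in> space M \<Longrightarrow> sets (N \<omega>) = sets \<mu>"
    and random_variable_N: "A \<in> sets \<mu> \<Longrightarrow> random_variable borel (\<lambda>\<omega>. emeasure (N \<omega>) A)"
    and N_poisson: "A \<in> sets \<mu> \<Longrightarrow> emeasure \<mu> A < \<infinity> \<Longrightarrow>
          prob {\<omega> \<in> space M. emeasure (N \<omega>) A = of_nat k} =
            measure \<mu> A ^ k / fact k * exp (- measure \<mu> A)"
    and N_infinite: "A \<in> sets \<mu> \<Longrightarrow> emeasure \<mu> A = \<infinity> \<Longrightarrow> AE \<omega> in M. emeasure (N \<omega>) A = \<infinity>"
    and N_indep: "(\<And>i. i < m \<Longrightarrow> C i \<in> sets \<mu>) \<Longrightarrow> disjoint_family_on C {..<m} \<Longrightarrow>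
          indep_vars (\<lambda>_. borel) (\<lambda>i \<omega>. emeasure (N \<omega>) (C i)) {..<(m::nat)}"

text \<open>
  A measure on \<open>\<real> \<setminus> {0}\<close> is represented by a Borel measure on the line without mass at the origin.
\<close>

locale levy_measure =
  fixes n :: "real measure"
  assumes sets_n: "sets n = sets borel"
    and n_zero: "emeasure n {0} = 0"
    and n_levy: "(\<integral>\<^sup>+ y. ennreal (min (y\<^sup>2) 1) \<partial>n) < \<infinity>"

text \<open>The measure \<open>ds n(dy)\<close> on \<open>[0,\<infinity>) \<times> (\<real> \<setminus> {0})\<close>, extended by zero to the plane.\<close>

definition jump_intensity :: "real measure \<Rightarrow> (real \<times> real) measure" where
  "jump_intensity n = density lborel (indicator {0..}) \<Otimes>\<^sub>M n"

definition large_jumps :: "('a \<Rightarrow> (real \<times> real) measure) \<Rightarrow> real \<Rightarrow> 'a \<Rightarrow> real" where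
  "large_jumps N t \<omega> = (LINT z:{0<..t} \<times> {y. 1 \<le> \<bar>y\<bar>}|N \<omega>. snd z)"

definition truncated_small_jumps ::
    "('a \<Rightarrow> (real \<times> real) measure) \<Rightarrow> real measure \<Rightarrow> real \<Rightarrow> real \<Rightarrow> 'a \<Rightarrow> real" where
  "truncated_small_jumps N n \<epsilon> t \<omega> =
     (LINT z:{0<..t} \<times> {y. \<epsilon> \<le> \<bar>y\<bar> \<and> \<bar>y\<bar> < 1}|N \<omega>. snd z) -
     t * (LINT y:{y. \<epsilon> \<le> \<bar>y\<bar> \<and> \<bar>y\<bar> < 1}|n. y)"

text \<open>
  The integral of \<open>y\<close> over \<open>(0,t] \<times> {0 < |y| < 1}\<close> against the compensated measure
  \<open>N(ds dy) - ds n(dy)\<close> is an \<open>L\<^sup>2\<close> limit, since neither \<open>N\<close> nor its compensator need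
  integrate \<open>y\<close> near the origin.
\<close>

definition (in prob_space) is_compensated_small_jumps ::
    "('a \<Rightarrow> (real \<times> real) measure) \<Rightarrow> real measure \<Rightarrow> real \<Rightarrow> ('a \<Rightarrow> real) \<Rightarrow> bool" where
  "is_compensated_small_jumps N n t Z \<longleftrightarrow>
     random_variable borel Z \<and>
     ((\<lambda>\<epsilon>. \<integral>\<^sup>+ \<omega>. ennreal ((truncated_small_jumps N n \<epsilon> t \<omega> - Z \<omega>)\<^sup>2) \<partial>M) \<longlongrightarrow> 0) (at_right 0)"

locale levy_ito_process =
  levy_process M X + brownian_motion M B + levy_measure n +
  poisson_random_measure M "jump_intensity n" N
  for M :: "'a measure" and X :: "real \<Rightarrow> 'a \<Rightarrow> real" and \<sigma> b :: real
    and B :: "real \<Rightarrow> 'a \<Rightarrow> real" and n :: "real measure" and N :: "'a \<Rightarrow> (real \<times> real) measure" +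
  assumes B_N_indep: "indep_set
        (sigma_sets (space M) {B t -` A \<inter> space M | t A. 0 \<le> t \<and> A \<in> sets borel})
        (sigma_sets (space M) {(\<lambda>\<omega>. emeasure (N \<omega>) C) -` A \<inter> space M | C A.
           C \<in> sets (jump_intensity n) \<and> A \<in> sets borel})"
    and levy_ito_decomposition: "0 \<le> t \<Longrightarrow>
        \<exists>Z. is_compensated_small_jumps N n t Z \<and>
          (AE \<omega> in M. X t \<omega> = X 0 \<omega> + \<sigma> * B t \<omega> + b * t + large_jumps N t \<omega> + Z \<omega>)"

text \<open>
  The occupation density of \<open>X\<close> with respect to \<open>d[X,X]\<^sup>c\<^sub>s = \<sigma>\<^sup>2 ds\<close>, in the version that is
  continuous in space; \<open>L t x \<omega>\<close> is the local time at level \<open>x\<close> up to time \<open>t\<close>.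
\<close>

definition (in prob_space) is_local_time ::
    "(real \<Rightarrow> 'a \<Rightarrow> real) \<Rightarrow> real \<Rightarrow> (real \<Rightarrow> real \<Rightarrow> 'a \<Rightarrow> real) \<Rightarrow> bool" where
  "is_local_time X \<sigma> L \<longleftrightarrow>
     (\<forall>t\<ge>0. (\<forall>x. random_variable borel (L t x)) \<and>
       (AE \<omega> in M.
         (\<forall>x. 0 \<le> L t x \<omega>) \<and> continuous_on UNIV (\<lambda>x. L t x \<omega>) \<and>
         (\<forall>g :: real \<Rightarrow> ennreal. g \<in> borel_measurable borel \<longrightarrow>
            (\<integral>\<^sup>+ s\<in>{0..t}. g (X s \<omega>) * ennreal (\<sigma>\<^sup>2) \<partial>lborel) =
            (\<integral>\<^sup>+ x. g x * ennreal (L t x \<omega>) \<partial>lborel))))"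

text \<open>
  The supremum of \<open>\<Sum>i<m. |f (a (i+1)) - f (a i)|\<^sup>p\<close> over all finite partitions
  \<open>a 0 < \<dots> < a m\<close> of the line (the \<open>p\<close>-th power of the \<open>p\<close>-variation seminorm).
\<close>

definition p_variation :: "real \<Rightarrow> (real \<Rightarrow> real) \<Rightarrow> ennreal" where
  "p_variation p f =
     (SUP (m, a) \<in> {(m::nat, a::nat \<Rightarrow> real). strict_mono_on {..m} a}.
        \<Sum>i<m. ennreal (\<bar>f (a (Suc i)) - f (a i)\<bar> powr p))"

definition bounded_p_variation :: "real \<Rightarrow> (real \<Rightarrow> real) \<Rightarrow> bool" where
  "bounded_p_variation p f \<longleftrightarrow> p_variation p f < \<infinity>"

end

theory Submission
  imports Defs
begin

text \<open>
  This is Berman's Fourier approach to local times, applied to \<open>Y = X - X\<^sub>0\<close>. Since \<open>B\<close> is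
  independent of the jumps, the characteristic function of an increment of length \<open>d\<close> is bounded by
  \<open>exp (- \<sigma>\<^sup>2 \<theta>\<^sup>2 d / 2)\<close>. Mollify the occupation density with a Gaussian kernel and write the
  difference of its values at \<open>x\<close> and \<open>y\<close> as a time integral of \<open>\<integral> \<psi>(u) exp (i u Y\<^sub>r) du\<close> with
  \<open>|\<psi>(u)| \<le> 2 |x - y|\<^sup>\<gamma> |u|\<^sup>\<gamma>\<close>. Its \<open>k\<close>-th moment is an iterated integral over ordered times, which
  by independence of increments is at most a constant times \<open>|x - y|\<^bsup>\<gamma> k\<^esup>\<close>, uniformly in the
  mollification, as soon as \<open>\<gamma> < 1/2\<close>: this is where \<open>\<integral> (1 + |v|\<^sup>\<gamma>)\<^sup>2 / (1 + v\<^sup>2) dv\<close> has to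
  converge. For large even \<open>k\<close> the Kolmogorov--Chentsov chaining argument makes the continuous version
  Hoelder of exponent \<open>1/p < 1/2\<close>, and a compactly supported function with this property has bounded
  \<open>p\<close>-variation.
\<close>

section \<open>Hoelder continuity and p-variation\<close>

text \<open>The local time is known only through the occupation formula and continuity in space, so
  its moments are never computed directly. They are bounded for mollified occupation integrals of Y,
  which on almost every path converge to increments of L divided by \<open>\<sigma>\<^sup>2\<close>;
  Fatou carries the bound over. X_0 has to be removed because independence is assumed for increments
  only. It returns path by path as a shift of the levels, which affects neither Hoelder continuity
  nor p-variation. Origin of the bound 1/2: expand the k factors at frequencies u_1, ..., u_k.
  Between consecutive times the process is tested at a partial sum v_j of frequencies, and
  integrating out that time span gives a factor of order 1/(1 + v_j^2). Each u_j is a difference of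
  neighbouring partial sums, so |u_j|^\<gamma> is at most a product of one weight 1 + |v|^\<gamma>
  at each of them. A partial sum thus collects up to two weights, which is the square in the
  integral.\<close>

lemma holder_of_dyadic_increments:
  fixes f :: "real \<Rightarrow> real"
  assumes cont: "continuous_on UNIV f" and \<alpha>: "0 < \<alpha>" and C: "0 \<le> C"
    and inc: "\<And>n (j::int). \<bar>f ((real_of_int j + 1) / 2 ^ n) - f (real_of_int j / 2 ^ n)\<bar> \<le> C * (2 powr - \<alpha>) ^ n"
  shows "\<exists>K\<ge>0. \<forall>x y. \<bar>x - y\<bar> \<le> 1 \<longrightarrow> \<bar>f x - f y\<bar> \<le> K * \<bar>x - y\<bar> powr \<alpha>"
proof -
  define \<rho> :: real where "\<rho> = 2 powr - \<alpha>"
  have \<rho>: "0 < \<rho>" "\<rho> < 1"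
    using \<alpha> by (auto simp: \<rho>_def powr_less_one)
  define g where "g n x = f (of_int \<lfloor>2 ^ n * x\<rfloor> / 2 ^ n)" for n :: nat and x :: real
  have g_lim: "(\<lambda>n. g n x) \<longlonglongrightarrow> f x" for x
  proof -
    have "(\<lambda>n. of_int \<lfloor>2 ^ n * x\<rfloor> / 2 ^ n) \<longlonglongrightarrow> x"
    proof (rule real_tendsto_sandwich)
      show "\<forall>\<^sub>F n in sequentially. x - (1/2) ^ n \<le> of_int \<lfloor>2 ^ n * x\<rfloor> / 2 ^ n"
      proof (intro always_eventually allI)
        fix n :: nat
        have "2 ^ n * x - 1 \<le> of_int \<lfloor>2 ^ n * x\<rfloor>" by linarith
        then have "(2 ^ n * x - 1) / 2 ^ n \<le> of_int \<lfloor>2 ^ n * x\<rfloor> / 2 ^ n"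
          by (intro divide_right_mono) auto
        then show "x - (1/2) ^ n \<le> of_int \<lfloor>2 ^ n * x\<rfloor> / 2 ^ n"
          by (simp add: diff_divide_distrib power_one_over)
      qed
      show "\<forall>\<^sub>F n in sequentially. of_int \<lfloor>2 ^ n * x\<rfloor> / 2 ^ n \<le> x"
        by (intro always_eventually allI) (simp add: field_simps)
      show "(\<lambda>n. x - (1/2) ^ n) \<longlonglongrightarrow> x"
        by (rule tendsto_eq_intros LIMSEQ_power_zero | simp)+
    qed simp
    then show ?thesis
      unfolding g_def by (rule continuous_on_tendsto_compose[OF cont]) auto
  qed
  \<comment> \<open>Halving the mesh either keeps the left grid point of x or moves it to its right
    neighbour on the finer grid.\<close>
  have step: "\<bar>g (Suc n) x - g n x\<bar> \<le> C * \<rho> ^ Suc n" for n x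
  proof -
    define j where "j = \<lfloor>2 ^ n * x\<rfloor>"
    have j: "of_int j \<le> 2 ^ n * x" "2 ^ n * x < of_int j + 1"
      unfolding j_def by linarith+
    have "\<lfloor>2 ^ Suc n * x\<rfloor> = 2 * j \<or> \<lfloor>2 ^ Suc n * x\<rfloor> = 2 * j + 1"
    proof (cases "2 ^ Suc n * x < 2 * of_int j + 1")
      case True
      then have "\<lfloor>2 ^ Suc n * x\<rfloor> = 2 * j" using j by (intro floor_unique) auto
      then show ?thesis ..
    next
      case False
      then have "\<lfloor>2 ^ Suc n * x\<rfloor> = 2 * j + 1" using j by (intro floor_unique) auto
      then show ?thesis ..
    qed
    moreover have "g n x = f (of_int (2 * j) / 2 ^ Suc n)"
      by (simp add: g_def j_def)
    ultimately show ?thesis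
      using inc[of "2 * j" "Suc n"] C \<rho> unfolding g_def \<rho>_def[symmetric]
      by (auto simp del: power_Suc)
  qed
  \<comment> \<open>The sum of \<rho>^i over i >= 1; it bounds the whole chain of steps beyond a
    level.\<close>
  define q where "q = \<rho> / (1 - \<rho>)"
  have q: "0 \<le> q" using \<rho> by (simp add: q_def)
  have tail: "\<bar>f x - g n x\<bar> \<le> C * q * \<rho> ^ n" for n x
  proof -
    \<comment> \<open>The tail \<open>C * q * \<rho> ^ (n + m)\<close> is kept in reserve, and each
      further step consumes exactly \<open>C * \<rho> ^ Suc (n + m)\<close> of it.\<close>
    have "\<bar>g (n + m) x - g n x\<bar> \<le> C * q * \<rho> ^ n - C * q * \<rho> ^ (n + m)" for m
    proof (induction m)
      case (Suc m)
      have "C * q * \<rho> ^ (n + m) - C * q * \<rho> ^ (n + Suc m) = C * \<rho> ^ Suc (n + m)"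
      proof -
        have "q * (1 - \<rho>) = \<rho>" using \<rho> by (simp add: q_def)
        then have "q - q * \<rho> = \<rho>" by (simp add: algebra_simps)
        then have "C * \<rho> ^ (n + m) * (q - q * \<rho>) = C * \<rho> ^ (n + m) * \<rho>" by (rule arg_cong)
        moreover have "C * \<rho> ^ (n + m) * (q - q * \<rho>) = C * q * \<rho> ^ (n + m) - C * q * \<rho> ^ (n + Suc m)"
          by (simp add: algebra_simps)
        ultimately show ?thesis by simp
      qed
      then show ?case using Suc step[of "n + m" x] by (simp add: abs_le_iff)
    qed simp
    then have "\<bar>g (m + n) x - g n x\<bar> \<le> C * q * \<rho> ^ n" for m
      using C q \<rho> by (smt (verit) add.commute mult_nonneg_nonneg zero_le_power)
    moreover have "(\<lambda>m. \<bar>g (m + n) x - g n x\<bar>) \<longlonglongrightarrow> \<bar>f x - g n x\<bar>"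
      by (intro tendsto_intros LIMSEQ_ignore_initial_segment g_lim)
    ultimately show ?thesis
      using LIMSEQ_le_const2 by blast
  qed
  define K where "K = (2 * q + 1) * C * 2 powr \<alpha>"
  have main: "\<bar>f x - f y\<bar> \<le> K * \<bar>x - y\<bar> powr \<alpha>" if xy: "x < y" "y - x \<le> 1" for x y
  proof -
    have "(\<lambda>n. (1/2::real) ^ n) \<longlonglongrightarrow> 0" by (rule LIMSEQ_power_zero) simp
    then have "\<forall>\<^sub>F n in sequentially. (1/2::real) ^ n < y - x"
      using xy by (intro order_tendstoD) auto
    then obtain N0 where "(1/2::real) ^ N0 < y - x"
      by (auto simp: eventually_sequentially)
    \<comment> \<open>Minimality gives 2^(-N) < y - x <= 2^(-(N - 1)): at level N - 1 the grid
      points of x and y coincide or are neighbours, while 2^(-N) still bounds the distance from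
      below.\<close>
    define N where "N = (LEAST N. (1/2::real) ^ N < y - x)"
    have N: "(1/2::real) ^ N < y - x"
      unfolding N_def using \<open>(1/2::real) ^ N0 < y - x\<close> by (rule LeastI)
    have "N \<noteq> 0" using N xy by (intro notI) simp
    then obtain n where n: "N = Suc n" using not0_implies_Suc by blast
    have "\<not> (1/2::real) ^ n < y - x"
      using not_less_Least[of n "\<lambda>N. (1/2::real) ^ N < y - x"] n N_def by simp
    then have le: "2 ^ n * y \<le> 2 ^ n * x + 1"
      by (simp add: power_one_over field_simps)
    have "\<lfloor>2 ^ n * x\<rfloor> \<le> \<lfloor>2 ^ n * y\<rfloor>" using xy by (intro floor_mono) simp
    moreover have "\<lfloor>2 ^ n * y\<rfloor> \<le> \<lfloor>2 ^ n * x\<rfloor> + 1" using le by linarith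
    ultimately have "\<lfloor>2 ^ n * y\<rfloor> = \<lfloor>2 ^ n * x\<rfloor> \<or> \<lfloor>2 ^ n * y\<rfloor> = \<lfloor>2 ^ n * x\<rfloor> + 1" by linarith
    then have "\<bar>g n y - g n x\<bar> \<le> C * \<rho> ^ n"
      unfolding g_def \<rho>_def using inc[of "\<lfloor>2 ^ n * x\<rfloor>" n] C by (auto simp: add_ac)
    then have "\<bar>f x - f y\<bar> \<le> (2 * q + 1) * C * \<rho> ^ n"
      using tail[of x n] tail[of y n] by (simp add: algebra_simps abs_le_iff)
    also have "\<rho> ^ n = 2 powr \<alpha> * ((1/2) ^ N) powr \<alpha>"
    proof -
      have "((1/2::real) ^ N) powr \<alpha> = (2 powr - real N) powr \<alpha>"
        by (simp add: powr_minus powr_realpow power_one_over inverse_eq_divide)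
      then show ?thesis
        by (simp add: \<rho>_def powr_powr n powr_add[symmetric] powr_power[of 2] algebra_simps)
    qed
    also have "(2 * q + 1) * C * (2 powr \<alpha> * ((1/2) ^ N) powr \<alpha>) \<le> K * (y - x) powr \<alpha>"
    proof -
      have "((1/2) ^ N) powr \<alpha> \<le> (y - x) powr \<alpha>"
        using N \<alpha> by (intro powr_mono2) auto
      then show ?thesis
        unfolding K_def using q C by (simp add: mult_left_mono mult.assoc)
    qed
    finally show ?thesis using xy by simp
  qed
  have "\<bar>f x - f y\<bar> \<le> K * \<bar>x - y\<bar> powr \<alpha>" if "\<bar>x - y\<bar> \<le> 1" for x y
    using main[of x y] main[of y x] that
    by (cases x y rule: linorder_cases) (auto simp: abs_minus_commute)
  moreover have "0 \<le> K" using q C by (simp add: K_def)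
  ultimately show ?thesis by blast
qed

lemma bounded_of_continuous_compact_support:
  fixes f :: "real \<Rightarrow> real"
  assumes cont: "continuous_on UNIV f" and supp: "\<And>x. R < \<bar>x\<bar> \<Longrightarrow> f x = 0"
  obtains F where "0 \<le> F" "\<And>x. \<bar>f x\<bar> \<le> F"
proof -
  have "compact (f ` {- \<bar>R\<bar>..\<bar>R\<bar>})"
    by (intro compact_continuous_image continuous_on_subset[OF cont]) auto
  then obtain F0 where F0: "\<And>x. x \<in> {- \<bar>R\<bar>..\<bar>R\<bar>} \<Longrightarrow> \<bar>f x\<bar> \<le> F0"
    by (metis bounded_iff compact_imp_bounded image_eqI real_norm_def)
  have "\<bar>f x\<bar> \<le> max F0 0" for x
    using F0[of x] supp[of x] by (cases "x \<in> {- \<bar>R\<bar>..\<bar>R\<bar>}") auto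
  then show ?thesis using that[of "max F0 0"] by simp
qed

text \<open>The exponent 1/p turns p-th powers of increments into multiples of interval lengths,
  which telescope; compact support keeps the total length finite.\<close>

lemma bounded_p_variation_of_holder:
  fixes f :: "real \<Rightarrow> real"
  assumes cont: "continuous_on UNIV f" and K: "0 \<le> K" and p: "0 < p"
    and holder: "\<And>x y. \<bar>x - y\<bar> \<le> 1 \<Longrightarrow> \<bar>f x - f y\<bar> \<le> K * \<bar>x - y\<bar> powr (1 / p)"
    and supp: "\<And>x. R < \<bar>x\<bar> \<Longrightarrow> f x = 0"
  shows "bounded_p_variation p f"
proof -
  define S where "S = \<bar>R\<bar> + 1"
  obtain F where F_nn: "0 \<le> F" and F: "\<And>x. \<bar>f x\<bar> \<le> F"
    using bounded_of_continuous_compact_support[OF cont supp] by blast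
  \<comment> \<open>Increments over distances above 1 are at most 2 F, and there the power of the
    distance is at least 1.\<close>
  define K' where "K' = K + 2 * F"
  have holder': "\<bar>f x - f y\<bar> \<le> K' * \<bar>x - y\<bar> powr (1 / p)" for x y
  proof (cases "\<bar>x - y\<bar> \<le> 1")
    case True
    have "K * \<bar>x - y\<bar> powr (1 / p) \<le> K' * \<bar>x - y\<bar> powr (1 / p)"
      using F_nn by (intro mult_right_mono) (auto simp: K'_def)
    then show ?thesis using holder[OF True] by linarith
  next
    case False
    then have "1 \<le> \<bar>x - y\<bar> powr (1 / p)"
      using p by (intro ge_one_powr_ge_zero) auto
    then have "K' * 1 \<le> K' * \<bar>x - y\<bar> powr (1 / p)"
      using F_nn K by (intro mult_left_mono) (auto simp: K'_def)
    then show ?thesis using F[of x] F[of y] K by (auto simp: K'_def abs_le_iff)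
  qed
  \<comment> \<open>Points outside [-S, S] are moved to its ends. As S exceeds |R|, f vanishes at
    the ends too, so no value of f changes.\<close>
  define cl where "cl x = max (- S) (min S x)" for x :: real
  have f_cl: "f (cl x) = f x" for x
    using supp[of x] supp[of "cl x"] by (auto simp: cl_def S_def max_def min_def)
  have bound: "(\<Sum>i<m. ennreal (\<bar>f (a (Suc i)) - f (a i)\<bar> powr p)) \<le> ennreal (K' powr p * (2 * S))"
    if a: "strict_mono_on {..m} a" for m and a :: "nat \<Rightarrow> real"
  proof -
    have term_le: "\<bar>f (a (Suc i)) - f (a i)\<bar> powr p \<le> K' powr p * (cl (a (Suc i)) - cl (a i))" if "i < m" for i
    proof -
      have "a i < a (Suc i)" using a that by (auto simp: strict_mono_on_def)
      then have le: "cl (a i) \<le> cl (a (Suc i))" by (auto simp: cl_def)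
      have "\<bar>f (a (Suc i)) - f (a i)\<bar> \<le> K' * \<bar>cl (a (Suc i)) - cl (a i)\<bar> powr (1 / p)"
        using holder'[of "cl (a (Suc i))" "cl (a i)"] by (simp add: f_cl)
      then have "\<bar>f (a (Suc i)) - f (a i)\<bar> powr p \<le> (K' * \<bar>cl (a (Suc i)) - cl (a i)\<bar> powr (1 / p)) powr p"
        using p by (intro powr_mono2) auto
      also have "\<dots> = K' powr p * (cl (a (Suc i)) - cl (a i))"
        using le p K F_nn by (simp add: powr_mult powr_powr K'_def)
      finally show ?thesis .
    qed
    have "(\<Sum>i<m. ennreal (\<bar>f (a (Suc i)) - f (a i)\<bar> powr p)) = ennreal (\<Sum>i<m. \<bar>f (a (Suc i)) - f (a i)\<bar> powr p)"
      by (simp add: sum_ennreal)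
    also have "\<dots> \<le> ennreal (\<Sum>i<m. K' powr p * (cl (a (Suc i)) - cl (a i)))"
      using term_le by (intro ennreal_leI sum_mono) auto
    also have "(\<Sum>i<m. K' powr p * (cl (a (Suc i)) - cl (a i))) = K' powr p * (cl (a m) - cl (a 0))"
      using sum_lessThan_telescope[of "\<lambda>i. cl (a i)" m] by (simp add: sum_distrib_left[symmetric])
    also have "\<dots> \<le> K' powr p * (2 * S)"
    proof (intro mult_left_mono)
      have "cl (a m) \<le> S" "- S \<le> cl (a 0)" by (auto simp: cl_def S_def)
      then show "cl (a m) - cl (a 0) \<le> 2 * S" by linarith
    qed simp
    finally show ?thesis by (simp add: ennreal_leI)
  qed
  have "p_variation p f \<le> ennreal (K' powr p * (2 * S))"
    unfolding p_variation_def
  proof (rule SUP_least, clarify)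
    fix m and a :: "nat \<Rightarrow> real"
    assume "strict_mono_on {..m} a"
    then show "(\<Sum>i<m. ennreal (\<bar>f (a (Suc i)) - f (a i)\<bar> powr p)) \<le> ennreal (K' powr p * (2 * S))"
      by (rule bound)
  qed
  then show ?thesis
    unfolding bounded_p_variation_def using ennreal_less_top order.strict_trans1 by fastforce
qed

text \<open>One-sided limits bound f near each time, and [0, t] is compact. Applied to a path, this
  confines the occupation density to a compact set.\<close>

lemma cadlag_bounded:
  assumes "cadlag f" and "0 \<le> t"
  obtains R where "\<And>s. 0 \<le> s \<Longrightarrow> s \<le> t \<Longrightarrow> \<bar>f s\<bar> \<le> R"
proof -
  have loc: "\<exists>U R. open U \<and> s \<in> U \<and> (\<forall>r\<in>U \<inter> {0..t}. \<bar>f r\<bar> \<le> R)" if s: "s \<in> {0..t}" for s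
  proof -
    have "(f \<longlongrightarrow> f s) (at_right s)" using assms s by (auto simp: cadlag_def)
    then have "\<forall>\<^sub>F r in at_right s. dist (f r) (f s) < 1" by (rule tendstoD) simp
    then obtain b where b: "s < b" "\<And>r. s < r \<Longrightarrow> r < b \<Longrightarrow> \<bar>f r\<bar> \<le> \<bar>f s\<bar> + 1"
      unfolding eventually_at_right_field dist_real_def by (smt (verit))
    have "\<exists>a R. a < s \<and> (\<forall>r. a < r \<and> r < s \<and> 0 \<le> r \<longrightarrow> \<bar>f r\<bar> \<le> R)"
    proof (cases "s = 0")
      \<comment> \<open>At 0 there is no left limit, but no nonnegative time lies to its left
        either.\<close>
      case True
      then show ?thesis by (intro exI[of _ "-1"]) auto
    next
      case False
      then obtain l where "(f \<longlongrightarrow> l) (at_left s)" using assms s unfolding cadlag_def by fastforce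
      then have "\<forall>\<^sub>F r in at_left s. dist (f r) l < 1" by (rule tendstoD) simp
      then obtain a where "a < s" "\<And>r. a < r \<Longrightarrow> r < s \<Longrightarrow> \<bar>f r\<bar> \<le> \<bar>l\<bar> + 1"
        unfolding eventually_at_left_field dist_real_def by (smt (verit))
      then show ?thesis by blast
    qed
    then obtain a R where a: "a < s" "\<And>r. a < r \<Longrightarrow> r < s \<Longrightarrow> 0 \<le> r \<Longrightarrow> \<bar>f r\<bar> \<le> R" by blast
    have "\<bar>f r\<bar> \<le> max R (\<bar>f s\<bar> + 1)" if "r \<in> {a<..<b} \<inter> {0..t}" for r
      using a(2)[of r] b(2)[of r] that by (cases r s rule: linorder_cases) auto
    then show ?thesis
      using a(1) b(1) by (intro exI[of _ "{a<..<b}"] exI[of _ "max R (\<bar>f s\<bar> + 1)"]) auto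
  qed
  then obtain U R where UR: "\<And>s. s \<in> {0..t} \<Longrightarrow> open (U s) \<and> s \<in> U s \<and> (\<forall>r\<in>U s \<inter> {0..t}. \<bar>f r\<bar> \<le> R s)"
    by metis
  obtain T where T: "T \<subseteq> {0..t}" "finite T" "{0..t} \<subseteq> (\<Union>s\<in>T. U s)"
    using compactE_image[of "{0..t}" "{0..t}" U] UR by blast
  have "\<bar>f r\<bar> \<le> Max (R ` T)" if r: "0 \<le> r" "r \<le> t" for r
  proof -
    obtain s where s: "s \<in> T" "r \<in> U s" using T r by (auto simp: subset_iff)
    then have "\<bar>f r\<bar> \<le> R s" using UR T r by auto
    also have "\<dots> \<le> Max (R ` T)" using T s by simp
    finally show ?thesis .
  qed
  then show ?thesis using that by blast
qed

section \<open>Powers of time integrals\<close>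

text \<open>Lets \<open>measurable\<close> treat indicators of intervals whose end points are
  themselves integration variables.\<close>

lemma pred_interval [measurable (raw)]:
  fixes f g h :: "'a \<Rightarrow> real"
  assumes [measurable]: "f \<in> borel_measurable M" "g \<in> borel_measurable M" "h \<in> borel_measurable M"
  shows "Measurable.pred M (\<lambda>x. g x \<in> {f x<..<h x})" "Measurable.pred M (\<lambda>x. g x \<in> {..<h x})"
    "Measurable.pred M (\<lambda>x. g x \<in> {f x..})"
  by simp_all

text \<open>The integral of \<alpha>(r1) ... \<alpha>(rk) over the simplex s > r1 > ... > rk > 0,
  with the latest time outermost.\<close>

primrec iterated_integral :: "(real \<Rightarrow> real) \<Rightarrow> nat \<Rightarrow> real \<Rightarrow> real" where
  "iterated_integral \<alpha> 0 s = 1"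
| "iterated_integral \<alpha> (Suc k) s = (LBINT r. indicator {0<..<s} r * (\<alpha> r * iterated_integral \<alpha> k r))"

lemma iterated_integral_measurable_param:
  assumes [measurable]: "(\<lambda>(r, \<omega>). \<alpha> \<omega> r) \<in> borel_measurable (borel \<Otimes>\<^sub>M M)"
  shows "(\<lambda>(s, \<omega>). iterated_integral (\<alpha> \<omega>) k s) \<in> borel_measurable (borel \<Otimes>\<^sub>M M)"
proof (induction k)
  case (Suc k)
  note [measurable] = Suc
  show ?case by simp
qed simp

lemma iterated_integral_measurable [measurable]:
  assumes "\<alpha> \<in> borel_measurable borel"
  shows "iterated_integral \<alpha> k \<in> borel_measurable borel"
proof -
  \<comment> \<open>A one-point parameter space makes this an instance of the parametrised
    statement.\<close>
  have "(\<lambda>(r, \<omega>::unit). \<alpha> r) \<in> borel_measurable (borel \<Otimes>\<^sub>M count_space UNIV)"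
    using assms by measurable
  then have "(\<lambda>(s, \<omega>::unit). iterated_integral \<alpha> k s) \<in> borel_measurable (borel \<Otimes>\<^sub>M count_space UNIV)"
    by (rule iterated_integral_measurable_param)
  then have "(\<lambda>s. case (s, ()) of (s, \<omega>::unit) \<Rightarrow> iterated_integral \<alpha> k s) \<in> borel_measurable borel"
    by (rule measurable_compose[rotated]) auto
  then show ?thesis by simp
qed

lemma integrable_indicator_interval_mult:
  fixes f :: "real \<Rightarrow> real"
  assumes [measurable]: "f \<in> borel_measurable borel" and K: "\<And>r. 0 < r \<Longrightarrow> r < s \<Longrightarrow> \<bar>f r\<bar> \<le> K"
  shows "integrable lborel (\<lambda>r. indicator {0<..<s} r * f r)"
proof (rule Bochner_Integration.integrable_bound)
  show "integrable lborel (\<lambda>r. indicator {0<..<s} r * K)"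
    by (cases "0 \<le> s") (auto simp: integrable_indicator_iff)
  show "AE r in lborel. norm (indicator {0<..<s} r * f r) \<le> norm (indicator {0<..<s} r * K)"
    using K by (intro AE_I2) (auto simp: indicator_def intro: order.trans[OF _ abs_ge_self])
qed simp

text \<open>Serves integrability only, so the volume factor 1/k! of the simplex is given
  away.\<close>

lemma iterated_integral_bound:
  assumes [measurable]: "\<alpha> \<in> borel_measurable borel" and \<alpha>: "\<And>r. \<bar>\<alpha> r\<bar> \<le> A" and s: "0 \<le> s"
  shows "\<bar>iterated_integral \<alpha> k s\<bar> \<le> (A * s) ^ k"
  using s
proof (induction k arbitrary: s)
  case (Suc k)
  have A: "0 \<le> A" using \<alpha>[of 0] by linarith
  have le: "\<bar>\<alpha> r * iterated_integral \<alpha> k r\<bar> \<le> A * (A * s) ^ k" if "0 < r" "r < s" for r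
  proof -
    have "\<bar>iterated_integral \<alpha> k r\<bar> \<le> (A * r) ^ k" using that by (intro Suc.IH) simp
    also have "\<dots> \<le> (A * s) ^ k" using that A by (intro power_mono mult_left_mono) auto
    finally show ?thesis
      using \<alpha>[of r] A by (simp add: abs_mult mult_mono)
  qed
  have "\<bar>iterated_integral \<alpha> (Suc k) s\<bar> \<le> (LBINT r. indicator {0<..<s} r * (A * (A * s) ^ k))"
    unfolding iterated_integral.simps
  proof (rule integral_abs_bound_integral)
    show "integrable lborel (\<lambda>r. indicator {0<..<s} r * (\<alpha> r * iterated_integral \<alpha> k r))"
      using le by (intro integrable_indicator_interval_mult) auto
    show "integrable lborel (\<lambda>r. indicator {0<..<s} r * (A * (A * s) ^ k))"
      by (intro integrable_indicator_interval_mult) auto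
    show "\<bar>indicator {0<..<s} r * (\<alpha> r * iterated_integral \<alpha> k r)\<bar> \<le> indicator {0<..<s} r * (A * (A * s) ^ k)" for r
      using le[of r] by (auto simp: indicator_def)
  qed
  also have "\<dots> = (A * s) ^ Suc k"
    using Suc.prems by simp
  finally show ?case .
qed simp

text \<open>Fubini over the plane cut along the diagonal r = q, a null set that may go to either
  half.\<close>

lemma integral_mult_integral:
  fixes f g :: "real \<Rightarrow> real"
  assumes f: "integrable lborel f" and g: "integrable lborel g"
  shows "(LBINT r. f r) * (LBINT q. g q) =
    (LBINT r. f r * (LBINT q. indicator {..<r} q * g q)) + (LBINT q. g q * (LBINT r. indicator {..<q} r * f r))"
proof -
  have [measurable]: "f \<in> borel_measurable borel" "g \<in> borel_measurable borel"
    using f g by auto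
  have fg: "integrable (lborel \<Otimes>\<^sub>M lborel) (\<lambda>(r, q). f r * g q)"
  proof (rule lborel_pair.Fubini_integrable)
    show "AE r in lborel. integrable lborel (\<lambda>q. case (r, q) of (r, q) \<Rightarrow> f r * g q)"
      using g by simp
    have "(\<lambda>r. LBINT q. norm (case (r, q) of (r, q) \<Rightarrow> f r * g q)) = (\<lambda>r. \<bar>f r\<bar> * (LBINT q. \<bar>g q\<bar>))"
      by (simp add: abs_mult)
    then show "integrable lborel (\<lambda>r. LBINT q. norm (case (r, q) of (r, q) \<Rightarrow> f r * g q))"
      using f by simp
  qed simp
  have int1: "integrable (lborel \<Otimes>\<^sub>M lborel) (\<lambda>(r, q). f r * (indicator {..<r} q * g q))"
    by (rule Bochner_Integration.integrable_bound[OF fg]) (auto simp: indicator_def)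
  have int2: "integrable (lborel \<Otimes>\<^sub>M lborel) (\<lambda>(r, q). f r * (indicator {r..} q * g q))"
    by (rule Bochner_Integration.integrable_bound[OF fg]) (auto simp: indicator_def)
  have "(LBINT r. f r) * (LBINT q. g q) = (LBINT r. LBINT q. f r * g q)"
    by simp
  also have "\<dots> = (\<integral>(r, q). f r * g q \<partial>(lborel \<Otimes>\<^sub>M lborel))"
    using lborel_pair.integral_fst'[OF fg] by simp
  also have "\<dots> = (\<integral>z. (case z of (r, q) \<Rightarrow> f r * (indicator {..<r} q * g q)) +
      (case z of (r, q) \<Rightarrow> f r * (indicator {r..} q * g q)) \<partial>(lborel \<Otimes>\<^sub>M lborel))"
    by (intro Bochner_Integration.integral_cong) (auto simp: indicator_def)
  also have "\<dots> = (\<integral>(r, q). f r * (indicator {..<r} q * g q) \<partial>(lborel \<Otimes>\<^sub>M lborel)) +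
      (\<integral>(r, q). f r * (indicator {r..} q * g q) \<partial>(lborel \<Otimes>\<^sub>M lborel))"
    by (rule Bochner_Integration.integral_add[OF int1 int2])
  also have "(\<integral>(r, q). f r * (indicator {..<r} q * g q) \<partial>(lborel \<Otimes>\<^sub>M lborel)) =
      (LBINT r. f r * (LBINT q. indicator {..<r} q * g q))"
    using lborel_pair.integral_fst'[OF int1] by simp
  also have "(\<integral>(r, q). f r * (indicator {r..} q * g q) \<partial>(lborel \<Otimes>\<^sub>M lborel)) =
      (LBINT q. LBINT r. f r * (indicator {r..} q * g q))"
    using lborel_pair.integral_snd[OF int2] by simp
  also have "\<dots> = (LBINT q. g q * (LBINT r. indicator {..<q} r * f r))"
  proof (rule Bochner_Integration.integral_cong[OF refl])
    fix q :: real
    have "(LBINT r. f r * (indicator {r..} q * g q)) = (LBINT r. g q * (indicator {..<q} r * f r))"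
    proof (rule integral_cong_AE)
      show "AE r in lborel. f r * (indicator {r..} q * g q) = g q * (indicator {..<q} r * f r)"
        using AE_lborel_singleton[of q] by eventually_elim (auto simp: indicator_def)
    qed measurable
    then show "(LBINT r. f r * (indicator {r..} q * g q)) = g q * (LBINT r. indicator {..<q} r * f r)"
      by simp
  qed
  finally show ?thesis .
qed

text \<open>A shuffle identity: the extra time can take k + 1 positions among the ordered ones. In
  the induction it is either the latest time, which gives one copy of the next integral, or lies
  below the latest time, where the induction hypothesis applies inside the integral.\<close>

lemma iterated_integral_mult:
  assumes [measurable]: "\<alpha> \<in> borel_measurable borel" and \<alpha>: "\<And>r. \<bar>\<alpha> r\<bar> \<le> A"
  shows "iterated_integral \<alpha> 1 s * iterated_integral \<alpha> k s = (real k + 1) * iterated_integral \<alpha> (Suc k) s"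
proof (induction k arbitrary: s)
  case (Suc k)
  define F where "F k r = indicator {0<..<s} r * (\<alpha> r * iterated_integral \<alpha> k r)" for k r
  have int: "integrable lborel (F k)" for k
    unfolding F_def
  proof (rule integrable_indicator_interval_mult)
    fix r assume r: "0 < r" "r < s"
    have A: "0 \<le> A" using \<alpha>[of 0] by linarith
    have "\<bar>iterated_integral \<alpha> k r\<bar> \<le> (A * r) ^ k"
      using r \<alpha> by (intro iterated_integral_bound) auto
    also have "\<dots> \<le> (A * s) ^ k" using r A by (intro power_mono mult_left_mono) auto
    finally show "\<bar>\<alpha> r * iterated_integral \<alpha> k r\<bar> \<le> A * (A * s) ^ k"
      using \<alpha>[of r] A by (simp add: abs_mult mult_mono)
  qed measurable
  have cut: "F j r * (LBINT q. indicator {..<r} q * F l q) = F j r * iterated_integral \<alpha> (Suc l) r" for j l r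
  proof (cases "0 < r \<and> r < s")
    case True
    then have "indicator {..<r} q * F l q = indicator {0<..<r} q * (\<alpha> q * iterated_integral \<alpha> l q)" for q
      by (auto simp: F_def indicator_def)
    then show ?thesis by simp
  qed (auto simp: F_def)
  have "iterated_integral \<alpha> 1 s * iterated_integral \<alpha> (Suc k) s = (LBINT r. F 0 r) * (LBINT q. F k q)"
    by (simp add: F_def)
  also have "\<dots> = (LBINT r. F 0 r * iterated_integral \<alpha> (Suc k) r) + (LBINT q. F k q * iterated_integral \<alpha> 1 q)"
    unfolding integral_mult_integral[OF int int] cut by (simp only: One_nat_def)
  also have "(LBINT r. F 0 r * iterated_integral \<alpha> (Suc k) r) = iterated_integral \<alpha> (Suc (Suc k)) s"
    by (simp add: F_def mult_ac)
  also have "(\<lambda>q. F k q * iterated_integral \<alpha> 1 q) = (\<lambda>q. (real k + 1) * F (Suc k) q)"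
  proof
    fix q
    have "F k q * iterated_integral \<alpha> 1 q = indicator {0<..<s} q * \<alpha> q * (iterated_integral \<alpha> 1 q * iterated_integral \<alpha> k q)"
      by (simp only: F_def mult_ac)
    also have "\<dots> = (real k + 1) * F (Suc k) q"
      unfolding Suc.IH F_def by (simp only: mult_ac)
    finally show "F k q * iterated_integral \<alpha> 1 q = (real k + 1) * F (Suc k) q" .
  qed
  also have "(LBINT q. (real k + 1) * F (Suc k) q) = (real k + 1) * iterated_integral \<alpha> (Suc (Suc k)) s"
    unfolding F_def by (simp only: integral_mult_right_zero iterated_integral.simps)
  finally show ?case by (simp only: of_nat_Suc) (simp only: algebra_simps)
qed simp

text \<open>The cube (0, s)^k consists of k! simplices, one for each order of the times.\<close>

lemma power_iterated_integral:
  assumes \<alpha>: "\<alpha> \<in> borel_measurable borel" "\<And>r. \<bar>\<alpha> r\<bar> \<le> A"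
  shows "(LBINT r. indicator {0<..<s} r * \<alpha> r) ^ k = fact k * iterated_integral \<alpha> k s"
proof (induction k)
  case (Suc k)
  have "(LBINT r. indicator {0<..<s} r * \<alpha> r) ^ Suc k = iterated_integral \<alpha> 1 s * (fact k * iterated_integral \<alpha> k s)"
    using Suc by simp
  also have "\<dots> = fact k * (iterated_integral \<alpha> 1 s * iterated_integral \<alpha> k s)"
    by (simp only: mult_ac)
  also have "\<dots> = fact (Suc k) * iterated_integral \<alpha> (Suc k) s"
    by (simp only: iterated_integral_mult[OF \<alpha>] fact_Suc of_nat_mult) (simp add: algebra_simps)
  finally show ?case .
qed simp

section \<open>Moments of time integrals from Fourier decay\<close>

text \<open>
  An entry \<open>(d, \<theta>)\<close> of the list is an increment over a time span of length \<open>d\<close>, tested at the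
  frequency \<open>\<theta>\<close>; the spans follow each other, the first one starting at \<open>s\<close>.
\<close>

primrec future_char :: "(real \<Rightarrow> real) \<Rightarrow> real \<Rightarrow> (real \<times> real) list \<Rightarrow> complex" where
  "future_char y s [] = 1"
| "future_char y s (D # Ds) = iexp (snd D * (y (s + fst D) - y s)) * future_char y (s + fst D) Ds"

text \<open>For c = \<open>\<sigma>\<^sup>2 / 2\<close> this is the joint characteristic function of
  the Brownian parts of the increments.\<close>

primrec damping :: "real \<Rightarrow> (real \<times> real) list \<Rightarrow> real" where
  "damping c [] = 1"
| "damping c (D # Ds) = exp (- (c * (snd D)\<^sup>2 * fst D)) * damping c Ds"

lemma norm_future_char [simp]: "cmod (future_char y s Ds) = 1"
  by (induction Ds arbitrary: s) (auto simp: norm_mult)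

lemma future_char_measurable [measurable]:
  assumes [measurable]: "\<And>r. Y r \<in> borel_measurable M"
  shows "(\<lambda>\<omega>. future_char (\<lambda>r. Y r \<omega>) s Ds) \<in> borel_measurable M"
proof (induction Ds arbitrary: s)
  case (Cons D Ds)
  note [measurable] = Cons
  show ?case by simp
qed simp

lemma damping_nonneg [simp]: "0 \<le> damping c Ds"
  by (induction Ds) auto

text \<open>The Fourier expansion of the iterated integral with every phase replaced by its damping:
  for times s > r1 > ... > rk > 0, the span from r(j+1) to rj is tested at the frequency \<eta> + u1
  + ... + uj, and the last span reaches down to 0. Values in \<open>ennreal\<close> postpone all
  questions of finiteness.\<close>

primrec damped_kernel :: "real \<Rightarrow> (real \<Rightarrow> complex) \<Rightarrow> nat \<Rightarrow> real \<Rightarrow> real \<Rightarrow> ennreal" where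
  "damped_kernel c \<psi> 0 s \<eta> = ennreal (exp (- (c * \<eta>\<^sup>2 * s)))"
| "damped_kernel c \<psi> (Suc k) s \<eta> =
    (\<integral>\<^sup>+r. indicator {0<..<s} r * ennreal (exp (- (c * \<eta>\<^sup>2 * (s - r)))) *
      (\<integral>\<^sup>+u. ennreal (cmod (\<psi> u)) * damped_kernel c \<psi> k r (\<eta> + u) \<partial>lborel) \<partial>lborel)"

lemma damped_kernel_measurable [measurable]:
  assumes [measurable]: "\<psi> \<in> borel_measurable borel"
  shows "(\<lambda>(s, \<eta>). damped_kernel c \<psi> k s \<eta>) \<in> borel_measurable (borel \<Otimes>\<^sub>M borel)"
proof (induction k)
  case (Suc k)
  note [measurable] = Suc
  show ?case by simp
qed simp

lemma (in pair_sigma_finite) integrable_mult_pair: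
  fixes f :: "'a \<Rightarrow> real" and g :: "'b \<Rightarrow> real"
  assumes f: "integrable M1 f" and g: "integrable M2 g"
  shows "integrable (M1 \<Otimes>\<^sub>M M2) (\<lambda>(x, y). f x * g y)"
proof (rule Fubini_integrable)
  have [measurable]: "f \<in> borel_measurable M1" "g \<in> borel_measurable M2" using f g by auto
  show "(\<lambda>(x, y). f x * g y) \<in> borel_measurable (M1 \<Otimes>\<^sub>M M2)" by measurable
  show "AE x in M1. integrable M2 (\<lambda>y. case (x, y) of (x, y) \<Rightarrow> f x * g y)"
    using g by simp
  have "(\<lambda>x. \<integral>y. norm (case (x, y) of (x, y) \<Rightarrow> f x * g y) \<partial>M2) = (\<lambda>x. \<bar>f x\<bar> * (\<integral>y. \<bar>g y\<bar> \<partial>M2))"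
    by (simp add: abs_mult)
  then show "integrable M1 (\<lambda>x. \<integral>y. norm (case (x, y) of (x, y) \<Rightarrow> f x * g y) \<partial>M2)"
    using f by simp
qed

text \<open>Isolates what the moment estimate uses of the process: joint measurability for Fubini,
  and Gaussian decay of the joint characteristic function of the value at s and the increments after
  s.\<close>

locale fourier_damped_process = prob_space M for M :: "'a measure" +
  fixes Y :: "real \<Rightarrow> 'a \<Rightarrow> real" and c :: real
  assumes Y_measurable [measurable]: "(\<lambda>(s, \<omega>). Y s \<omega>) \<in> borel_measurable (borel \<Otimes>\<^sub>M M)"
    and c_pos: "0 < c"
    and damped: "0 < s \<Longrightarrow> (\<And>D. D \<in> set Ds \<Longrightarrow> 0 < fst D) \<Longrightarrow>
      cmod (\<integral>\<omega>. iexp (\<eta> * Y s \<omega>) * future_char (\<lambda>r. Y r \<omega>) s Ds \<partial>M) \<le> exp (- (c * \<eta>\<^sup>2 * s)) * damping c Ds"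
begin

text \<open>
  The increments \<open>Ds\<close> after time \<open>s\<close> are what makes the induction on \<open>k\<close> go through: at the outermost
  integration time \<open>r < s\<close> the factor \<open>exp (i \<eta> Y\<^sub>s)\<close> splits into \<open>exp (i \<eta> Y\<^sub>r)\<close> and one more future
  increment, so no conditioning on the past is needed.
\<close>

lemma iterated_integral_char_bound:
  fixes \<alpha> :: "real \<Rightarrow> real" and \<psi> :: "real \<Rightarrow> complex"
  assumes \<alpha>_meas [measurable]: "\<alpha> \<in> borel_measurable borel" and \<alpha>_bd: "\<And>z. \<bar>\<alpha> z\<bar> \<le> A"
    and \<psi>_int: "integrable lborel \<psi>" and \<alpha>_eq: "\<And>z. complex_of_real (\<alpha> z) = (LBINT u. \<psi> u * iexp (u * z))"
    and s: "0 < s" and Ds: "\<And>D. D \<in> set Ds \<Longrightarrow> 0 < fst D"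
  shows "ennreal (cmod (\<integral>\<omega>. iexp (\<eta> * Y s \<omega>) * future_char (\<lambda>r. Y r \<omega>) s Ds *
      complex_of_real (iterated_integral (\<lambda>r. \<alpha> (Y r \<omega>)) k s) \<partial>M)) \<le>
    ennreal (damping c Ds) * damped_kernel c \<psi> k s \<eta>"
  using s Ds
proof (induction k arbitrary: s \<eta> Ds)
  case 0
  then show ?case
    using damped[of s Ds \<eta>] by (simp add: ennreal_mult'[symmetric] mult.commute ennreal_leI)
next
  case (Suc k)
  have [measurable]: "\<psi> \<in> borel_measurable borel" using \<psi>_int by auto
  have A: "0 \<le> A" using \<alpha>_bd[of 0] by linarith
  define E where "E \<omega> = iexp (\<eta> * Y s \<omega>) * future_char (\<lambda>r. Y r \<omega>) s Ds" for \<omega>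
  have E_meas [measurable]: "E \<in> borel_measurable M" unfolding E_def by measurable
  have norm_E: "cmod (E \<omega>) = 1" for \<omega> by (simp add: E_def norm_mult)
  define J where "J r \<omega> = iterated_integral (\<lambda>r. \<alpha> (Y r \<omega>)) k r" for r \<omega>
  have J_meas [measurable]: "(\<lambda>(r, \<omega>). J r \<omega>) \<in> borel_measurable (borel \<Otimes>\<^sub>M M)"
    unfolding J_def by (rule iterated_integral_measurable_param) measurable
  \<comment> \<open>The outermost factor \<alpha> is replaced by its Fourier integral; z is the pair
    of the time r and the frequency u.\<close>
  define F where "F \<omega> z = E \<omega> * complex_of_real (indicator {0<..<s} (fst z) * J (fst z) \<omega>) * (\<psi> (snd z) * iexp (snd z * Y (fst z) \<omega>))"
    for \<omega> and z :: "real \<times> real"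
  have F_meas [measurable]: "(\<lambda>(\<omega>, z). F \<omega> z) \<in> borel_measurable (M \<Otimes>\<^sub>M (lborel \<Otimes>\<^sub>M lborel))"
    unfolding F_def by measurable
  \<comment> \<open>A majorant free of \<omega>: it serves both on each single path and for Fubini
    with the probability space.\<close>
  define G where "G = (\<lambda>(r, u). (indicator {0<..<s} r * (A * s) ^ k) * cmod (\<psi> u))"
  have G_int: "integrable (lborel \<Otimes>\<^sub>M lborel) G"
    unfolding G_def using \<psi>_int
    by (intro lborel_pair.integrable_mult_pair integrable_indicator_interval_mult) auto
  have path_meas: "(\<lambda>r. \<alpha> (Y r \<omega>)) \<in> borel_measurable borel" if "\<omega> \<in> space M" for \<omega>
    using that by measurable
  have F_le: "norm (F \<omega> z) \<le> norm (G z)" if \<omega>: "\<omega> \<in> space M" for \<omega> z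
  proof (cases "0 < fst z \<and> fst z < s")
    case True
    have "\<bar>J (fst z) \<omega>\<bar> \<le> (A * fst z) ^ k"
      unfolding J_def using True path_meas[OF \<omega>] \<alpha>_bd by (intro iterated_integral_bound) auto
    also have "\<dots> \<le> (A * s) ^ k" using True A by (intro power_mono mult_left_mono) auto
    finally have "\<bar>J (fst z) \<omega>\<bar> * cmod (\<psi> (snd z)) \<le> \<bar>(A * s) ^ k\<bar> * cmod (\<psi> (snd z))"
      by (intro mult_right_mono) auto
    then show ?thesis
      using True by (simp add: F_def G_def norm_mult norm_E abs_mult case_prod_beta)
  qed (auto simp: F_def)
  have F_int: "integrable (lborel \<Otimes>\<^sub>M lborel) (F \<omega>)" if "\<omega> \<in> space M" for \<omega>
  proof (rule Bochner_Integration.integrable_bound[OF G_int])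
    show "F \<omega> \<in> borel_measurable (lborel \<Otimes>\<^sub>M lborel)" using that by measurable
    show "AE z in lborel \<Otimes>\<^sub>M lborel. norm (F \<omega> z) \<le> norm (G z)" using F_le[OF that] by simp
  qed
  interpret Q: pair_sigma_finite M "lborel \<Otimes>\<^sub>M lborel :: (real \<times> real) measure" ..
  have "integrable (M \<Otimes>\<^sub>M (lborel \<Otimes>\<^sub>M lborel)) (\<lambda>(\<omega>, z). 1 * G z)"
    using G_int by (intro Q.integrable_mult_pair) auto
  then have F_int_pair: "integrable (M \<Otimes>\<^sub>M (lborel \<Otimes>\<^sub>M lborel)) (\<lambda>(\<omega>, z). F \<omega> z)"
  proof (rule Bochner_Integration.integrable_bound)
    show "AE x in M \<Otimes>\<^sub>M (lborel \<Otimes>\<^sub>M lborel). norm (case x of (\<omega>, z) \<Rightarrow> F \<omega> z) \<le> norm (case x of (\<omega>, z) \<Rightarrow> 1 * G z)"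
      using F_le by (intro AE_I2) (auto simp: space_pair_measure)
  qed measurable
  have expand: "E \<omega> * complex_of_real (iterated_integral (\<lambda>r. \<alpha> (Y r \<omega>)) (Suc k) s) = (\<integral>z. F \<omega> z \<partial>(lborel \<Otimes>\<^sub>M lborel))"
    if \<omega>: "\<omega> \<in> space M" for \<omega>
  proof -
    have "(\<integral>z. F \<omega> z \<partial>(lborel \<Otimes>\<^sub>M lborel)) = (LBINT r. LBINT u. F \<omega> (r, u))"
      using lborel_pair.integral_fst'[OF F_int[OF \<omega>]] by simp
    also have "\<dots> = (LBINT r. E \<omega> * complex_of_real (indicator {0<..<s} r * (\<alpha> (Y r \<omega>) * J r \<omega>)))"
    proof (rule Bochner_Integration.integral_cong[OF refl])
      fix r
      have "(LBINT u. F \<omega> (r, u)) = E \<omega> * complex_of_real (indicator {0<..<s} r * J r \<omega>) * complex_of_real (\<alpha> (Y r \<omega>))"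
        by (simp add: F_def \<alpha>_eq)
      then show "(LBINT u. F \<omega> (r, u)) = E \<omega> * complex_of_real (indicator {0<..<s} r * (\<alpha> (Y r \<omega>) * J r \<omega>))"
        by (simp add: mult_ac)
    qed
    also have "\<dots> = E \<omega> * complex_of_real (LBINT r. indicator {0<..<s} r * (\<alpha> (Y r \<omega>) * J r \<omega>))"
      by (simp only: integral_mult_right_zero integral_complex_of_real)
    finally show ?thesis by (simp add: J_def)
  qed
  have term_bound: "ennreal (cmod (\<integral>\<omega>. F \<omega> (r, u) \<partial>M)) \<le>
      ennreal (damping c Ds) * (indicator {0<..<s} r * ennreal (exp (- (c * \<eta>\<^sup>2 * (s - r)))) *
        (ennreal (cmod (\<psi> u)) * damped_kernel c \<psi> k r (\<eta> + u)))" for r u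
  proof (cases "0 < r \<and> r < s")
    case True
    have "F \<omega> (r, u) = \<psi> u * (iexp ((\<eta> + u) * Y r \<omega>) * future_char (\<lambda>r. Y r \<omega>) r ((s - r, \<eta>) # Ds) * complex_of_real (J r \<omega>))" for \<omega>
    proof -
      have "iexp (\<eta> * Y s \<omega>) * iexp (u * Y r \<omega>) = iexp ((\<eta> + u) * Y r \<omega>) * iexp (\<eta> * (Y s \<omega> - Y r \<omega>))"
        by (simp add: exp_add[symmetric] algebra_simps)
      then show ?thesis
        using True by (simp add: F_def E_def mult_ac)
    qed
    then have "(\<integral>\<omega>. F \<omega> (r, u) \<partial>M) = \<psi> u * (\<integral>\<omega>. iexp ((\<eta> + u) * Y r \<omega>) * future_char (\<lambda>r. Y r \<omega>) r ((s - r, \<eta>) # Ds) *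
        complex_of_real (iterated_integral (\<lambda>r. \<alpha> (Y r \<omega>)) k r) \<partial>M)" (is "_ = \<psi> u * ?I")
      by (simp add: J_def)
    then have "ennreal (cmod (\<integral>\<omega>. F \<omega> (r, u) \<partial>M)) = ennreal (cmod (\<psi> u)) * ennreal (cmod ?I)"
      by (simp only: norm_mult ennreal_mult'' norm_ge_zero)
    also have "\<dots> \<le> ennreal (cmod (\<psi> u)) * (ennreal (damping c ((s - r, \<eta>) # Ds)) * damped_kernel c \<psi> k r (\<eta> + u))"
      using True Suc.prems by (intro mult_left_mono Suc.IH) auto
    also have "\<dots> = ennreal (damping c Ds) * (indicator {0<..<s} r * ennreal (exp (- (c * \<eta>\<^sup>2 * (s - r)))) *
        (ennreal (cmod (\<psi> u)) * damped_kernel c \<psi> k r (\<eta> + u)))"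
      using True by (simp add: ennreal_mult mult_ac)
    finally show ?thesis .
  qed (auto simp: F_def)
  have "(\<integral>\<omega>. E \<omega> * complex_of_real (iterated_integral (\<lambda>r. \<alpha> (Y r \<omega>)) (Suc k) s) \<partial>M) =
      (\<integral>\<omega>. (\<integral>z. F \<omega> z \<partial>(lborel \<Otimes>\<^sub>M lborel)) \<partial>M)"
    by (intro Bochner_Integration.integral_cong refl expand)
  also have "\<dots> = (\<integral>z. (\<integral>\<omega>. F \<omega> z \<partial>M) \<partial>(lborel \<Otimes>\<^sub>M lborel))"
    by (rule Q.Fubini_integral[OF F_int_pair, symmetric])
  finally have "ennreal (cmod (\<integral>\<omega>. E \<omega> * complex_of_real (iterated_integral (\<lambda>r. \<alpha> (Y r \<omega>)) (Suc k) s) \<partial>M)) \<le>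
      (\<integral>\<^sup>+z. ennreal (cmod (\<integral>\<omega>. F \<omega> z \<partial>M)) \<partial>(lborel \<Otimes>\<^sub>M lborel))"
    using integral_norm_bound_ennreal[OF Q.integrable_snd[OF F_int_pair]] by simp
  also have "\<dots> \<le> (\<integral>\<^sup>+z. (case z of (r, u) \<Rightarrow> ennreal (damping c Ds) * (indicator {0<..<s} r * ennreal (exp (- (c * \<eta>\<^sup>2 * (s - r)))) *
        (ennreal (cmod (\<psi> u)) * damped_kernel c \<psi> k r (\<eta> + u)))) \<partial>(lborel \<Otimes>\<^sub>M lborel))"
    using term_bound by (intro nn_integral_mono) (auto split: prod.split)
  also have "\<dots> = (\<integral>\<^sup>+r. \<integral>\<^sup>+u. ennreal (damping c Ds) * (indicator {0<..<s} r * ennreal (exp (- (c * \<eta>\<^sup>2 * (s - r)))) *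
        (ennreal (cmod (\<psi> u)) * damped_kernel c \<psi> k r (\<eta> + u))) \<partial>lborel \<partial>lborel)"
    by (subst lborel.nn_integral_fst[symmetric]) auto
  also have "\<dots> = ennreal (damping c Ds) * damped_kernel c \<psi> (Suc k) s \<eta>"
    by (simp add: nn_integral_cmult)
  finally show ?case by (simp only: E_def)
qed

end

section \<open>Kernel estimates: frequency weights and time integration\<close>

definition growth_weight :: "real \<Rightarrow> real \<Rightarrow> real" where
  "growth_weight \<gamma> v = 1 + \<bar>v\<bar> powr \<gamma>"

text \<open>The cost of one intermediate frequency v: two weights, one from each neighbouring
  difference of partial sums, against the decay 1/(1 + v^2) left by a time integration.\<close>

definition weight_integral :: "real \<Rightarrow> ennreal" where
  "weight_integral \<gamma> = (\<integral>\<^sup>+v. ennreal ((growth_weight \<gamma> v)\<^sup>2 / (1 + v\<^sup>2)) \<partial>lborel)"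

lemma growth_weight_ge_1: "1 \<le> growth_weight \<gamma> v"
  by (simp add: growth_weight_def)

lemma growth_weight_measurable [measurable]: "growth_weight \<gamma> \<in> borel_measurable borel"
  unfolding growth_weight_def by measurable

text \<open>For |v| > 1 the integrand is at most 4 |v|^(2 \<gamma> - 2), and \<gamma> < 1/2 puts
  this exponent below -1.\<close>

lemma weight_integral_finite:
  assumes \<gamma>: "0 < \<gamma>" "\<gamma> < 1 / 2"
  shows "weight_integral \<gamma> < \<infinity>"
proof -
  define e where "e = 2 * \<gamma> - 2"
  have e: "e < -1" using \<gamma> by (simp add: e_def)
  define h where "h v = ennreal (4 * v powr e) * indicator {1..} v" for v :: real
  have [measurable]: "h \<in> borel_measurable borel" unfolding h_def by measurable
  have h: "(\<integral>\<^sup>+v. h v \<partial>lborel) < \<infinity>"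
  proof -
    have "((\<lambda>v. 4 * (v powr e)) has_integral 4 * - (1 powr (e + 1)) / (e + 1)) {1..}"
      using has_integral_mult_right[OF has_integral_powr_to_inf[OF e, of 1], of 4] by simp
    then show ?thesis
      unfolding h_def by (subst nn_integral_has_integral_lebesgue') auto
  qed
  have "weight_integral \<gamma> \<le> (\<integral>\<^sup>+v. ennreal 4 * indicator {-1..1} v + (h v + h (- v)) \<partial>lborel)"
    unfolding weight_integral_def
  proof (rule nn_integral_mono)
    fix v :: real
    show "ennreal ((growth_weight \<gamma> v)\<^sup>2 / (1 + v\<^sup>2)) \<le> ennreal 4 * indicator {-1..1} v + (h v + h (- v))"
    proof (cases "\<bar>v\<bar> \<le> 1")
      case True
      then have "\<bar>v\<bar> powr \<gamma> \<le> 1" using \<gamma> by (intro powr_le1) auto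
      then have "(growth_weight \<gamma> v)\<^sup>2 \<le> 2\<^sup>2" by (intro power_mono) (auto simp: growth_weight_def)
      then have "(growth_weight \<gamma> v)\<^sup>2 / (1 + v\<^sup>2) \<le> 4 / 1" by (intro frac_le) auto
      then have "ennreal ((growth_weight \<gamma> v)\<^sup>2 / (1 + v\<^sup>2)) \<le> ennreal 4" by (intro ennreal_leI) simp
      also have "\<dots> \<le> ennreal 4 * indicator {-1..1} v + (h v + h (- v))" using True by (auto simp: indicator_def abs_le_iff add_increasing2)
      finally show ?thesis .
    next
      case False
      then have "1 \<le> \<bar>v\<bar> powr \<gamma>" using \<gamma> by (intro ge_one_powr_ge_zero) auto
      then have "(growth_weight \<gamma> v)\<^sup>2 \<le> (2 * \<bar>v\<bar> powr \<gamma>)\<^sup>2" by (intro power_mono) (auto simp: growth_weight_def)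
      then have "(growth_weight \<gamma> v)\<^sup>2 / (1 + v\<^sup>2) \<le> (2 * \<bar>v\<bar> powr \<gamma>)\<^sup>2 / \<bar>v\<bar>\<^sup>2"
        using False by (intro frac_le) auto
      also have "\<dots> = 4 * \<bar>v\<bar> powr e"
        using False by (simp add: e_def power_mult_distrib powr_diff powr_power)
      finally have "ennreal ((growth_weight \<gamma> v)\<^sup>2 / (1 + v\<^sup>2)) \<le> ennreal (4 * \<bar>v\<bar> powr e)" by (rule ennreal_leI)
      also have "\<dots> \<le> h v + h (- v)"
        using False by (cases "0 \<le> v") (auto simp: h_def)
      finally show ?thesis by (simp add: add_increasing)
    qed
  qed
  also have "\<dots> = ennreal 4 * 2 + ((\<integral>\<^sup>+v. h v \<partial>lborel) + (\<integral>\<^sup>+v. h (- v) \<partial>lborel))"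
    by (simp add: nn_integral_add nn_integral_cmult_indicator)
  also have "(\<integral>\<^sup>+v. h (- v) \<partial>lborel) = (\<integral>\<^sup>+v. h v \<partial>lborel)"
    using nn_integral_real_affine[of h "-1" 0] by simp
  also have "ennreal 4 * 2 + ((\<integral>\<^sup>+v. h v \<partial>lborel) + (\<integral>\<^sup>+v. h v \<partial>lborel)) < \<infinity>"
    using h by (simp add: ennreal_mult_less_top)
  finally show ?thesis .
qed

text \<open>Decouples neighbouring partial sums of frequencies. Subadditivity of the power comes
  from z <= z^\<gamma> on [0, 1], applied to the shares of a and b in a + b.\<close>

lemma powr_abs_diff_le:
  assumes "0 < \<gamma>" "\<gamma> \<le> 1"
  shows "\<bar>v - \<eta>\<bar> powr \<gamma> \<le> growth_weight \<gamma> \<eta> * growth_weight \<gamma> v"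
proof -
  have sub: "(a + b) powr \<gamma> \<le> a powr \<gamma> + b powr \<gamma>" if ab: "0 \<le> a" "0 \<le> b" for a b :: real
  proof (cases "a + b = 0")
    case False
    then have pos: "0 < a + b" using ab by simp
    have *: "z \<le> z powr \<gamma>" if "0 \<le> z" "z \<le> 1" for z :: real
      using powr_mono'[of \<gamma> 1 z] that assms by (simp add: powr_one)
    have "1 = a / (a + b) + b / (a + b)" using pos by (simp add: add_divide_distrib[symmetric])
    also have "\<dots> \<le> (a / (a + b)) powr \<gamma> + (b / (a + b)) powr \<gamma>"
      using ab pos by (intro add_mono *) auto
    also have "\<dots> = (a powr \<gamma> + b powr \<gamma>) / (a + b) powr \<gamma>"
      using ab pos by (simp add: powr_divide add_divide_distrib)
    finally show ?thesis using pos by (simp add: field_simps)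
  qed (use ab in auto)
  have "\<bar>v - \<eta>\<bar> powr \<gamma> \<le> (\<bar>v\<bar> + \<bar>\<eta>\<bar>) powr \<gamma>" using assms by (intro powr_mono2) auto
  also have "\<dots> \<le> \<bar>v\<bar> powr \<gamma> + \<bar>\<eta>\<bar> powr \<gamma>" by (rule sub) auto
  also have "\<dots> \<le> growth_weight \<gamma> \<eta> * growth_weight \<gamma> v"
    by (simp add: growth_weight_def algebra_simps)
  finally show ?thesis .
qed

text \<open>Low frequencies use the interval length T, high ones the full exponential integral 1/(c
  \<eta>^2). Splitting at \<eta>^2 = 1 puts both under a multiple of 1/(1 + \<eta>^2), at the price
  of the factor 2.\<close>

lemma exp_decay_integral_le:
  assumes c: "0 < c" and T: "0 \<le> T" and r: "0 \<le> r"
  shows "(\<integral>\<^sup>+s. indicator {r<..<T} s * ennreal (exp (- (c * \<eta>\<^sup>2 * (s - r)))) \<partial>lborel) \<le>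
    ennreal (2 * max T (1 / c) / (1 + \<eta>\<^sup>2))" (is "?L \<le> _")
proof -
  have 1: "?L \<le> ennreal T"
  proof -
    have "?L \<le> (\<integral>\<^sup>+s. indicator {0..T} s \<partial>lborel)"
      using r c by (intro nn_integral_mono) (auto simp: indicator_def)
    then show ?thesis using T by simp
  qed
  have 2: "?L \<le> ennreal (1 / (c * \<eta>\<^sup>2))" if "\<eta> \<noteq> 0"
  proof -
    define l where "l = c * \<eta>\<^sup>2"
    have l: "0 < l" using c that by (simp add: l_def)
    have "((\<lambda>x. exp (- l * x)) has_integral exp (- l * 0) / l) {0..}"
      by (rule has_integral_exp_minus_to_infinity[OF l])
    then have "(\<integral>\<^sup>+s. ennreal (exp (- l * s)) * indicator {0..} s \<partial>lborel) = ennreal (1 / l)"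
      by (subst nn_integral_has_integral_lebesgue') auto
    moreover have "(\<integral>\<^sup>+s. ennreal (exp (- l * s)) * indicator {0..} s \<partial>lborel) =
        (\<integral>\<^sup>+s. ennreal (exp (- l * (s - r))) * indicator {0..} (s - r) \<partial>lborel)"
      using nn_integral_real_affine[of "\<lambda>s. ennreal (exp (- l * s)) * indicator {0..} s" 1 "- r"] by simp
    moreover have "?L \<le> (\<integral>\<^sup>+s. ennreal (exp (- l * (s - r))) * indicator {0..} (s - r) \<partial>lborel)"
      by (intro nn_integral_mono) (auto simp: indicator_def l_def)
    ultimately show ?thesis by (simp add: l_def)
  qed
  define m where "m = max T (1 / c)"
  have m: "T \<le> m" "1 / c \<le> m" "0 < m" using c by (auto simp: m_def less_max_iff_disj)
  show ?thesis
  proof (cases "\<eta>\<^sup>2 \<le> 1")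
    case True
    have "T * (1 + \<eta>\<^sup>2) \<le> m * 2" using True m T by (intro mult_mono) auto
    then have "T \<le> 2 * m / (1 + \<eta>\<^sup>2)"
      by (subst pos_le_divide_eq) (auto simp: add_pos_nonneg mult.commute)
    then show ?thesis using 1 unfolding m_def by (meson ennreal_leI order.trans)
  next
    case False
    then have \<eta>: "\<eta> \<noteq> 0" by auto
    have "1 / \<eta>\<^sup>2 = 2 / (2 * \<eta>\<^sup>2)" by simp
    also have "\<dots> \<le> 2 / (1 + \<eta>\<^sup>2)" using False by (intro divide_left_mono mult_pos_pos add_pos_pos) auto
    finally have *: "1 / \<eta>\<^sup>2 \<le> 2 / (1 + \<eta>\<^sup>2)" .
    have "1 / (c * \<eta>\<^sup>2) = (1 / c) * (1 / \<eta>\<^sup>2)" by simp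
    also have "\<dots> \<le> m * (2 / (1 + \<eta>\<^sup>2))"
      using m * by (intro mult_mono) auto
    finally have "1 / (c * \<eta>\<^sup>2) \<le> 2 * m / (1 + \<eta>\<^sup>2)" by (simp add: mult.commute)
    then show ?thesis using 2[OF \<eta>] unfolding m_def by (meson ennreal_leI order.trans)
  qed
qed

text \<open>With v = \<eta> + u the frequency u is a difference: one weight leaves as a factor at
  \<eta>, the other squares the weight already present at v. The prefactor B stays abstract to
  absorb the powers that accumulate in the induction.\<close>

lemma damped_kernel_weighted_integral_le:
  assumes [measurable]: "\<psi> \<in> borel_measurable borel" and \<gamma>: "0 < \<gamma>" "\<gamma> \<le> 1" and H: "0 \<le> H"
    and \<psi>: "\<And>u. cmod (\<psi> u) \<le> H * \<bar>u\<bar> powr \<gamma>" and C: "0 \<le> C"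
    and bound: "\<And>\<eta>. (\<integral>\<^sup>+s. indicator {0<..<T} s * damped_kernel c \<psi> k s \<eta> \<partial>lborel) \<le>
      B * ennreal (C * growth_weight \<gamma> \<eta> / (1 + \<eta>\<^sup>2))"
  shows "(\<integral>\<^sup>+r. indicator {0<..<T} r * (\<integral>\<^sup>+u. ennreal (cmod (\<psi> u)) * damped_kernel c \<psi> k r (\<eta> + u) \<partial>lborel) \<partial>lborel) \<le>
    B * (ennreal H * weight_integral \<gamma> * ennreal C) * ennreal (growth_weight \<gamma> \<eta>)" (is "?L \<le> _")
proof -
  have "?L = (\<integral>\<^sup>+r. (\<integral>\<^sup>+u. ennreal (cmod (\<psi> u)) * (indicator {0<..<T} r * damped_kernel c \<psi> k r (\<eta> + u)) \<partial>lborel) \<partial>lborel)"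
    by (simp add: nn_integral_cmult[symmetric] mult_ac)
  also have "\<dots> = (\<integral>\<^sup>+u. (\<integral>\<^sup>+r. ennreal (cmod (\<psi> u)) * (indicator {0<..<T} r * damped_kernel c \<psi> k r (\<eta> + u)) \<partial>lborel) \<partial>lborel)"
    by (rule lborel_pair.Fubini') measurable
  also have "\<dots> = (\<integral>\<^sup>+u. ennreal (cmod (\<psi> u)) * (\<integral>\<^sup>+r. indicator {0<..<T} r * damped_kernel c \<psi> k r (\<eta> + u) \<partial>lborel) \<partial>lborel)"
    by (simp add: nn_integral_cmult)
  also have "\<dots> \<le> (\<integral>\<^sup>+u. ennreal (H * \<bar>u\<bar> powr \<gamma>) * (B * ennreal (C * growth_weight \<gamma> (\<eta> + u) / (1 + (\<eta> + u)\<^sup>2))) \<partial>lborel)"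
    by (intro nn_integral_mono mult_mono ennreal_leI \<psi> bound) auto
  also have "\<dots> = (\<integral>\<^sup>+v. ennreal (H * \<bar>v - \<eta>\<bar> powr \<gamma>) * (B * ennreal (C * growth_weight \<gamma> v / (1 + v\<^sup>2))) \<partial>lborel)"
    by (subst nn_integral_real_affine[of _ 1 "- \<eta>"]) auto
  also have "\<dots> \<le> (\<integral>\<^sup>+v. (B * ennreal H * ennreal C * ennreal (growth_weight \<gamma> \<eta>)) * ennreal ((growth_weight \<gamma> v)\<^sup>2 / (1 + v\<^sup>2)) \<partial>lborel)"
  proof (rule nn_integral_mono)
    fix v :: real
    have q: "0 \<le> growth_weight \<gamma> v" "0 \<le> growth_weight \<gamma> \<eta>"
      using growth_weight_ge_1 order.trans zero_le_one by blast+
    have "ennreal (H * \<bar>v - \<eta>\<bar> powr \<gamma>) * (B * ennreal (C * growth_weight \<gamma> v / (1 + v\<^sup>2))) \<le>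
        ennreal (H * (growth_weight \<gamma> \<eta> * growth_weight \<gamma> v)) * (B * ennreal (C * growth_weight \<gamma> v / (1 + v\<^sup>2)))"
      using H \<gamma> by (intro mult_right_mono ennreal_leI mult_left_mono powr_abs_diff_le) auto
    also have "\<dots> = (B * ennreal H * ennreal C * ennreal (growth_weight \<gamma> \<eta>)) * ennreal ((growth_weight \<gamma> v)\<^sup>2 / (1 + v\<^sup>2))"
      using H C q by (simp add: ennreal_mult[symmetric] mult.assoc mult.left_commute[of _ B]) (simp add: power2_eq_square mult_ac)
    finally show "ennreal (H * \<bar>v - \<eta>\<bar> powr \<gamma>) * (B * ennreal (C * growth_weight \<gamma> v / (1 + v\<^sup>2))) \<le> \<dots>" .
  qed
  also have "\<dots> = B * (ennreal H * weight_integral \<gamma> * ennreal C) * ennreal (growth_weight \<gamma> \<eta>)"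
    by (simp add: nn_integral_cmult weight_integral_def mult_ac)
  finally show ?thesis .
qed

text \<open>The decay 1/(1 + \<eta>^2) appears only after integration in s: for small s the
  exponential is close to 1. Hence the induction runs on the time integral; Tonelli makes s the
  inner variable, so that the outermost exponential is integrated by itself.\<close>

lemma damped_kernel_integral_le:
  assumes [measurable]: "\<psi> \<in> borel_measurable borel" and \<gamma>: "0 < \<gamma>" "\<gamma> \<le> 1" and H: "0 \<le> H"
    and \<psi>: "\<And>u. cmod (\<psi> u) \<le> H * \<bar>u\<bar> powr \<gamma>" and c: "0 < c" and T: "0 \<le> T"
  shows "(\<integral>\<^sup>+s. indicator {0<..<T} s * damped_kernel c \<psi> k s \<eta> \<partial>lborel) \<le>
    (ennreal H * weight_integral \<gamma> * ennreal (2 * max T (1 / c))) ^ k *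
      ennreal (2 * max T (1 / c) * growth_weight \<gamma> \<eta> / (1 + \<eta>\<^sup>2))"
proof (induction k arbitrary: \<eta>)
  case 0
  define C where "C = 2 * max T (1 / c)"
  have C: "0 \<le> C" using T by (simp add: C_def)
  have "(\<integral>\<^sup>+s. indicator {0<..<T} s * damped_kernel c \<psi> 0 s \<eta> \<partial>lborel) \<le> ennreal (C / (1 + \<eta>\<^sup>2))"
    using exp_decay_integral_le[OF c T order.refl, of \<eta>] by (simp add: C_def)
  also have "C / (1 + \<eta>\<^sup>2) \<le> C * growth_weight \<gamma> \<eta> / (1 + \<eta>\<^sup>2)"
    using C growth_weight_ge_1[of \<gamma> \<eta>] by (intro divide_right_mono) (auto simp: mult_left_mono[of 1 "growth_weight \<gamma> \<eta>" C, simplified])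
  finally show ?case by (simp add: C_def ennreal_leI)
next
  case (Suc k)
  define C where "C = 2 * max T (1 / c)"
  have C: "0 \<le> C" using T by (simp add: C_def)
  define K where "K = ennreal H * weight_integral \<gamma> * ennreal C"
  define W where "W r = (\<integral>\<^sup>+u. ennreal (cmod (\<psi> u)) * damped_kernel c \<psi> k r (\<eta> + u) \<partial>lborel)" for r
  have [measurable]: "W \<in> borel_measurable borel" unfolding W_def by measurable
  have "(\<integral>\<^sup>+s. indicator {0<..<T} s * damped_kernel c \<psi> (Suc k) s \<eta> \<partial>lborel) =
      (\<integral>\<^sup>+s. \<integral>\<^sup>+r. indicator {0<..<T} s * (indicator {0<..<s} r * ennreal (exp (- (c * \<eta>\<^sup>2 * (s - r)))) * W r) \<partial>lborel \<partial>lborel)"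
    by (simp add: nn_integral_cmult W_def)
  also have "\<dots> = (\<integral>\<^sup>+r. \<integral>\<^sup>+s. indicator {0<..<T} s * (indicator {0<..<s} r * ennreal (exp (- (c * \<eta>\<^sup>2 * (s - r)))) * W r) \<partial>lborel \<partial>lborel)"
    by (rule lborel_pair.Fubini') measurable
  also have "\<dots> = (\<integral>\<^sup>+r. indicator {0<..<T} r * W r * (\<integral>\<^sup>+s. indicator {r<..<T} s * ennreal (exp (- (c * \<eta>\<^sup>2 * (s - r)))) \<partial>lborel) \<partial>lborel)"
    by (auto simp: nn_integral_cmult[symmetric] indicator_def mult.commute intro!: nn_integral_cong)
  also have "\<dots> \<le> (\<integral>\<^sup>+r. indicator {0<..<T} r * W r * ennreal (C / (1 + \<eta>\<^sup>2)) \<partial>lborel)"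
  proof (rule nn_integral_mono)
    fix r
    show "indicator {0<..<T} r * W r * (\<integral>\<^sup>+s. indicator {r<..<T} s * ennreal (exp (- (c * \<eta>\<^sup>2 * (s - r)))) \<partial>lborel) \<le>
      indicator {0<..<T} r * W r * ennreal (C / (1 + \<eta>\<^sup>2))"
    proof (cases "0 < r")
      case True
      then show ?thesis
        using exp_decay_integral_le[OF c T, of r \<eta>] by (intro mult_left_mono) (auto simp: C_def)
    qed simp
  qed
  also have "\<dots> = (\<integral>\<^sup>+r. indicator {0<..<T} r * W r \<partial>lborel) * ennreal (C / (1 + \<eta>\<^sup>2))"
    by (rule nn_integral_multc) measurable
  also have "\<dots> \<le> (K ^ k * K * ennreal (growth_weight \<gamma> \<eta>)) * ennreal (C / (1 + \<eta>\<^sup>2))"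
    unfolding W_def K_def
    using Suc.IH C by (intro mult_right_mono damped_kernel_weighted_integral_le \<gamma> H \<psi>) (auto simp: C_def)
  also have "\<dots> = K ^ Suc k * ennreal (C * growth_weight \<gamma> \<eta> / (1 + \<eta>\<^sup>2))"
    using C order.trans[OF zero_le_one growth_weight_ge_1[of \<gamma> \<eta>]]
    by (simp add: ennreal_mult[symmetric] mult.assoc mult_ac)
  finally show ?case by (simp only: K_def C_def)
qed

text \<open>The modulus stays outside the expectation because the decay comes from cancellation of
  phases.\<close>

lemma (in fourier_damped_process) integral_power_moment_le:
  fixes \<alpha> :: "real \<Rightarrow> real" and \<psi> :: "real \<Rightarrow> complex"
  assumes \<alpha>_meas [measurable]: "\<alpha> \<in> borel_measurable borel" and \<alpha>_bd: "\<And>z. \<bar>\<alpha> z\<bar> \<le> A"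
    and \<psi>_int: "integrable lborel \<psi>" and \<alpha>_eq: "\<And>z. complex_of_real (\<alpha> z) = (LBINT u. \<psi> u * iexp (u * z))"
    and \<gamma>: "0 < \<gamma>" "\<gamma> \<le> 1" and H: "0 \<le> H" and \<psi>: "\<And>u. cmod (\<psi> u) \<le> H * \<bar>u\<bar> powr \<gamma>"
    and t: "0 < t" and k: "0 < k"
  shows "ennreal \<bar>\<integral>\<omega>. (LBINT r. indicator {0<..<t} r * \<alpha> (Y r \<omega>)) ^ k \<partial>M\<bar> \<le>
    ennreal (fact k) * (ennreal H * weight_integral \<gamma> * ennreal (2 * max t (1 / c))) ^ k"
proof -
  obtain j where j: "k = Suc j" using k by (cases k) auto
  have [measurable]: "\<psi> \<in> borel_measurable borel" using \<psi>_int by auto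
  have "(\<integral>\<omega>. (LBINT r. indicator {0<..<t} r * \<alpha> (Y r \<omega>)) ^ k \<partial>M) = (\<integral>\<omega>. fact k * iterated_integral (\<lambda>r. \<alpha> (Y r \<omega>)) k t \<partial>M)"
    using \<alpha>_bd by (intro Bochner_Integration.integral_cong refl power_iterated_integral) measurable
  then have "ennreal \<bar>\<integral>\<omega>. (LBINT r. indicator {0<..<t} r * \<alpha> (Y r \<omega>)) ^ k \<partial>M\<bar> =
      ennreal (fact k) * ennreal \<bar>\<integral>\<omega>. iterated_integral (\<lambda>r. \<alpha> (Y r \<omega>)) k t \<partial>M\<bar>"
    by (simp add: abs_mult ennreal_mult)
  also have "\<bar>\<integral>\<omega>. iterated_integral (\<lambda>r. \<alpha> (Y r \<omega>)) k t \<partial>M\<bar> =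
      cmod (\<integral>\<omega>. iexp (0 * Y t \<omega>) * future_char (\<lambda>r. Y r \<omega>) t [] * complex_of_real (iterated_integral (\<lambda>r. \<alpha> (Y r \<omega>)) k t) \<partial>M)"
    by simp
  also have "ennreal \<dots> \<le> ennreal (damping c []) * damped_kernel c \<psi> k t 0"
    by (rule iterated_integral_char_bound[OF \<alpha>_meas \<alpha>_bd \<psi>_int \<alpha>_eq t]) simp
  \<comment> \<open>At \<eta> = 0 the outermost exponential is 1, which leaves the time integral of
    level k - 1 after one frequency integration. The weight at 0 equals 1 as well.\<close>
  also have "\<dots> = (\<integral>\<^sup>+r. indicator {0<..<t} r * (\<integral>\<^sup>+u. ennreal (cmod (\<psi> u)) * damped_kernel c \<psi> j r (0 + u) \<partial>lborel) \<partial>lborel)"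
    by (simp add: j)
  also have "\<dots> \<le> (ennreal H * weight_integral \<gamma> * ennreal (2 * max t (1 / c))) ^ j *
      (ennreal H * weight_integral \<gamma> * ennreal (2 * max t (1 / c))) * ennreal (growth_weight \<gamma> 0)"
    using t c_pos \<gamma> H \<psi> by (intro damped_kernel_weighted_integral_le damped_kernel_integral_le) auto
  also have "\<dots> = (ennreal H * weight_integral \<gamma> * ennreal (2 * max t (1 / c))) ^ k"
    by (simp add: j growth_weight_def mult.commute)
  finally show ?thesis by (simp add: mult_left_mono)
qed

section \<open>Characteristic functions of the increments\<close>

text \<open>\<open>G\<close> is arbitrary so that it can be the sigma-algebra generated by N:
  independence from B needs the jump integrals measurable with respect to that one.\<close>

lemma nn_integral_random_measure_measurable:
  fixes f :: "'b \<Rightarrow> ennreal"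
  assumes sets: "\<And>\<omega>. \<omega> \<in> space G \<Longrightarrow> sets (N \<omega>) = sets \<mu>"
    and meas: "\<And>C. C \<in> sets \<mu> \<Longrightarrow> (\<lambda>\<omega>. emeasure (N \<omega>) C) \<in> borel_measurable G"
    and f: "f \<in> borel_measurable \<mu>"
  shows "(\<lambda>\<omega>. \<integral>\<^sup>+x. f x \<partial>N \<omega>) \<in> borel_measurable G"
  using f
proof (induction f rule: borel_measurable_induct)
  case (cong f g)
  have "(\<integral>\<^sup>+x. f x \<partial>N \<omega>) = (\<integral>\<^sup>+x. g x \<partial>N \<omega>)" if "\<omega> \<in> space G" for \<omega>
    using cong(3) sets_eq_imp_space_eq[OF sets[OF that]] by (intro nn_integral_cong) auto
  then show ?case using cong(4) by (simp cong: measurable_cong)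
next
  case (set A)
  have "(\<integral>\<^sup>+x. indicator A x \<partial>N \<omega>) = emeasure (N \<omega>) A" if "\<omega> \<in> space G" for \<omega>
    using set sets[OF that] by simp
  then show ?case using meas[OF set] by (simp cong: measurable_cong)
next
  case (mult u c)
  have "(\<integral>\<^sup>+x. c * u x \<partial>N \<omega>) = c * (\<integral>\<^sup>+x. u x \<partial>N \<omega>)" if "\<omega> \<in> space G" for \<omega>
    using mult(2) measurable_cong_sets[OF sets[OF that] refl, of borel] by (intro nn_integral_cmult) auto
  then show ?case using mult by (simp cong: measurable_cong)
next
  case (add u v)
  have "(\<integral>\<^sup>+x. v x + u x \<partial>N \<omega>) = (\<integral>\<^sup>+x. v x \<partial>N \<omega>) + (\<integral>\<^sup>+x. u x \<partial>N \<omega>)" if "\<omega> \<in> space G" for \<omega>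
    using add measurable_cong_sets[OF sets[OF that] refl, of borel] by (intro nn_integral_add) auto
  then show ?case using add by (simp cong: measurable_cong)
next
  case (seq U)
  have "(\<integral>\<^sup>+x. (SUP i. U i) x \<partial>N \<omega>) = (SUP i. \<integral>\<^sup>+x. U i x \<partial>N \<omega>)" if "\<omega> \<in> space G" for \<omega>
  proof -
    have "(\<integral>\<^sup>+x. (SUP i. U i x) \<partial>N \<omega>) = (SUP i. \<integral>\<^sup>+x. U i x \<partial>N \<omega>)"
      using seq measurable_cong_sets[OF sets[OF that] refl, of borel]
      by (intro nn_integral_monotone_convergence_SUP) auto
    then show ?thesis by (simp add: SUP_apply image_comp comp_def)
  qed
  then show ?case using seq by (simp cong: measurable_cong)
qed

lemma lebesgue_integral_random_measure_measurable:
  fixes f :: "'b \<Rightarrow> real"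
  assumes sets: "\<And>\<omega>. \<omega> \<in> space G \<Longrightarrow> sets (N \<omega>) = sets \<mu>"
    and meas: "\<And>C. C \<in> sets \<mu> \<Longrightarrow> (\<lambda>\<omega>. emeasure (N \<omega>) C) \<in> borel_measurable G"
    and f [measurable]: "f \<in> borel_measurable \<mu>"
  shows "(\<lambda>\<omega>. \<integral>x. f x \<partial>N \<omega>) \<in> borel_measurable G"
proof -
  have [measurable]: "(\<lambda>\<omega>. \<integral>\<^sup>+x. g x \<partial>N \<omega>) \<in> borel_measurable G" if "g \<in> borel_measurable \<mu>" for g
    using sets meas that by (rule nn_integral_random_measure_measurable)
  \<comment> \<open>A non-integrable function has integral 0 by convention, so the difference of
    positive and negative part is guarded by finiteness.\<close>
  have "(\<integral>x. f x \<partial>N \<omega>) = (if (\<integral>\<^sup>+x. ennreal (norm (f x)) \<partial>N \<omega>) < \<infinity>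
      then enn2real (\<integral>\<^sup>+x. ennreal (f x) \<partial>N \<omega>) - enn2real (\<integral>\<^sup>+x. ennreal (- f x) \<partial>N \<omega>) else 0)"
    if "\<omega> \<in> space G" for \<omega>
  proof (cases "integrable (N \<omega>) f")
    case True
    then show ?thesis by (simp add: real_lebesgue_integral_def integrable_iff_bounded)
  next
    case False
    moreover have "f \<in> borel_measurable (N \<omega>)"
      using f by (subst measurable_cong_sets[OF sets[OF that] refl])
    ultimately show ?thesis
      by (simp add: not_integrable_integral_eq) (simp add: integrable_iff_bounded)
  qed
  then show ?thesis by (simp cong: measurable_cong)
qed

lemma norm_iexp_diff_le: "cmod (iexp x - iexp y) \<le> \<bar>x - y\<bar>"
proof -
  have "iexp x - iexp y = iexp y * (iexp (x - y) - 1)"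
    by (simp add: exp_diff algebra_simps)
  then have "cmod (iexp x - iexp y) = cmod (iexp (x - y) - 1)" by (simp add: norm_mult)
  also have "\<dots> \<le> \<bar>x - y\<bar>" using iexp_approx1[of "x - y" 0] by simp
  finally show ?thesis .
qed

section \<open>Gaussian damping of the increments\<close>

context levy_ito_process
begin

text \<open>The generator is spelled as in \<open>B_N_indep\<close>, so that the second family of
  events there is exactly \<open>sets jump_algebra\<close>.\<close>

definition jump_algebra :: "'a measure" where
  "jump_algebra = sigma (space M) {(\<lambda>\<omega>. emeasure (N \<omega>) C) -` A \<inter> space M | C A.
     C \<in> sets (jump_intensity n) \<and> A \<in> sets borel}"

lemma space_jump_algebra [simp]: "space jump_algebra = space M"
  unfolding jump_algebra_def by (rule space_measure_of) auto

lemma sets_jump_algebra: "sets jump_algebra = sigma_sets (space M) {(\<lambda>\<omega>. emeasure (N \<omega>) C) -` A \<inter> space M | C A.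
     C \<in> sets (jump_intensity n) \<and> A \<in> sets borel}"
  unfolding jump_algebra_def by (rule sets_measure_of) auto

lemma emeasure_jump_algebra_measurable:
  "C \<in> sets (jump_intensity n) \<Longrightarrow> (\<lambda>\<omega>. emeasure (N \<omega>) C) \<in> borel_measurable jump_algebra"
  by (rule measurableI) (auto simp: sets_jump_algebra intro!: sigma_sets.Basic)

lemma sets_jump_algebra_subset: "sets jump_algebra \<subseteq> events"
  using B_N_indep unfolding sets_jump_algebra indep_sets2_eq by simp

lemma measurable_jump_algebra_imp: "f \<in> borel_measurable jump_algebra \<Longrightarrow> f \<in> borel_measurable M"
  using sets_jump_algebra_subset by (auto simp: measurable_def)

lemma sets_jump_intensity: "sets (jump_intensity n) = sets (borel \<Otimes>\<^sub>M borel)"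
  unfolding jump_intensity_def by (intro sets_pair_measure_cong) (auto simp: sets_n)

lemma set_integral_jump_measurable:
  assumes "S \<in> sets (borel \<Otimes>\<^sub>M borel)"
  shows "(\<lambda>\<omega>. LINT z:S|N \<omega>. snd z) \<in> borel_measurable jump_algebra"
  unfolding set_lebesgue_integral_def
proof (rule lebesgue_integral_random_measure_measurable)
  show "(\<lambda>z. indicat_real S z *\<^sub>R snd z) \<in> borel_measurable (jump_intensity n)"
  proof -
    note [measurable] = assms
    have "(\<lambda>z. indicat_real S z *\<^sub>R snd z) \<in> borel_measurable (borel \<Otimes>\<^sub>M borel)" by measurable
    then show ?thesis by (subst measurable_cong_sets[OF sets_jump_intensity refl])
  qed
qed (auto simp: sets_N emeasure_jump_algebra_measurable)

lemma large_jumps_measurable: "large_jumps N t \<in> borel_measurable jump_algebra"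
proof -
  have "{y \<in> space borel. 1 \<le> \<bar>y::real\<bar>} \<in> sets borel" by measurable
  then have "{0<..t} \<times> {y::real. 1 \<le> \<bar>y\<bar>} \<in> sets (borel \<Otimes>\<^sub>M borel)" by (intro pair_measureI) auto
  then show ?thesis unfolding large_jumps_def by (rule set_integral_jump_measurable)
qed

lemma truncated_small_jumps_measurable: "truncated_small_jumps N n \<epsilon> t \<in> borel_measurable jump_algebra"
proof -
  have "{y \<in> space borel. \<epsilon> \<le> \<bar>y::real\<bar> \<and> \<bar>y\<bar> < 1} \<in> sets borel" by measurable
  then have "{0<..t} \<times> {y. \<epsilon> \<le> \<bar>y\<bar> \<and> \<bar>y\<bar> < 1} \<in> sets (borel \<Otimes>\<^sub>M borel)" by (intro pair_measureI) auto
  then show ?thesis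
    unfolding truncated_small_jumps_def
    by (intro borel_measurable_diff set_integral_jump_measurable borel_measurable_const)
qed

lemma expectation_iexp_B:
  assumes "0 < d"
  shows "(\<integral>\<omega>. iexp (\<theta> * B d \<omega>) \<partial>M) = complex_of_real (exp (- (\<theta>\<^sup>2 * d / 2)))"
proof -
  have [measurable]: "B d \<in> borel_measurable M" "B 0 \<in> borel_measurable M"
    using assms by (auto intro: random_variable_B)
  have "distributed M lborel (\<lambda>\<omega>. B d \<omega> - B 0 \<omega>) (normal_density 0 (sqrt d))"
    using B_increments_normal[of 0 d] assms by simp
  then have "distributed M lborel (\<lambda>\<omega>. (B d \<omega> - B 0 \<omega>) / sqrt d) std_normal_density"
    using normal_standard_normal_convert[of "sqrt d" "\<lambda>\<omega>. B d \<omega> - B 0 \<omega>" 0] assms by simp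
  then have distr: "distr M lborel (\<lambda>\<omega>. (B d \<omega> - B 0 \<omega>) / sqrt d) = std_normal_distribution"
    by (simp add: distributed_def)
  have "(\<integral>\<omega>. iexp (\<theta> * B d \<omega>) \<partial>M) = (\<integral>\<omega>. iexp ((\<theta> * sqrt d) * ((B d \<omega> - B 0 \<omega>) / sqrt d)) \<partial>M)"
  proof (rule integral_cong_AE)
    show "AE \<omega> in M. iexp (\<theta> * B d \<omega>) = iexp ((\<theta> * sqrt d) * ((B d \<omega> - B 0 \<omega>) / sqrt d))"
      using B_0 by eventually_elim (use assms in simp)
  qed measurable
  also have "\<dots> = char std_normal_distribution (\<theta> * sqrt d)"
    unfolding char_def distr[symmetric] by (subst integral_distr) auto
  also have "\<dots> = complex_of_real (exp (- (\<theta>\<^sup>2 * d / 2)))"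
    using assms by (simp add: char_std_normal_distribution power_mult_distrib)
  finally show ?thesis .
qed

text \<open>Independence splits off the Gaussian factor; whatever the jumps do, their characteristic
  function has modulus at most 1.\<close>

lemma norm_char_B_plus_jumps_le:
  assumes d: "0 < d" and U: "U \<in> borel_measurable jump_algebra"
  shows "cmod (\<integral>\<omega>. iexp (\<theta> * (\<sigma> * B d \<omega> + U \<omega>)) \<partial>M) \<le> exp (- (\<sigma>\<^sup>2 / 2 * \<theta>\<^sup>2 * d))"
proof -
  have [measurable]: "B d \<in> borel_measurable M" using d by (auto intro: random_variable_B)
  have UM [measurable]: "U \<in> borel_measurable M" by (rule measurable_jump_algebra_imp[OF U])
  have "indep_var borel (B d) borel U"
    unfolding indep_var_eq
  proof (intro conjI)
    have BN: "sigma_sets (space M) {B t -` A \<inter> space M | t A. 0 \<le> t \<and> A \<in> sets borel} \<subseteq> events"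
        "\<And>a c. a \<in> sigma_sets (space M) {B t -` A \<inter> space M | t A. 0 \<le> t \<and> A \<in> sets borel} \<Longrightarrow>
          c \<in> sets jump_algebra \<Longrightarrow> prob (a \<inter> c) = prob a * prob c"
      using B_N_indep unfolding sets_jump_algebra indep_sets2_eq by auto
    have 1: "sigma_sets (space M) {B d -` A \<inter> space M |A. A \<in> sets borel} \<subseteq>
        sigma_sets (space M) {B t -` A \<inter> space M | t A. 0 \<le> t \<and> A \<in> sets borel}"
      using d by (intro sigma_sets_mono') (auto intro: less_imp_le)
    have "{U -` A \<inter> space M |A. A \<in> sets borel} \<subseteq> sets jump_algebra"
      using measurable_sets[OF U] by auto
    then have 2: "sigma_sets (space M) {U -` A \<inter> space M |A. A \<in> sets borel} \<subseteq> sets jump_algebra"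
      using sets.sigma_sets_subset[of _ jump_algebra] by simp
    show "indep_set (sigma_sets (space M) {B d -` A \<inter> space M |A. A \<in> sets borel})
        (sigma_sets (space M) {U -` A \<inter> space M |A. A \<in> sets borel})"
      unfolding indep_sets2_eq using 1 2 BN sets_jump_algebra_subset by blast
  qed measurable
  then have "indep_var borel ((\<lambda>x. iexp (\<theta> * \<sigma> * x)) \<circ> B d) borel ((\<lambda>x. iexp (\<theta> * x)) \<circ> U)"
    by (rule indep_var_compose) auto
  then have "(\<integral>\<omega>. iexp (\<theta> * \<sigma> * B d \<omega>) * iexp (\<theta> * U \<omega>) \<partial>M) = (\<integral>\<omega>. iexp (\<theta> * \<sigma> * B d \<omega>) \<partial>M) * (\<integral>\<omega>. iexp (\<theta> * U \<omega>) \<partial>M)"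
    unfolding comp_def by (rule indep_var_lebesgue_integral) (auto intro: integrable_iexp)
  moreover have "iexp (\<theta> * (\<sigma> * B d \<omega> + U \<omega>)) = iexp (\<theta> * \<sigma> * B d \<omega>) * iexp (\<theta> * U \<omega>)" for \<omega>
    by (simp add: exp_add[symmetric] algebra_simps)
  ultimately have "(\<integral>\<omega>. iexp (\<theta> * (\<sigma> * B d \<omega> + U \<omega>)) \<partial>M) = (\<integral>\<omega>. iexp (\<theta> * \<sigma> * B d \<omega>) \<partial>M) * (\<integral>\<omega>. iexp (\<theta> * U \<omega>) \<partial>M)"
    by simp
  also have "(\<integral>\<omega>. iexp (\<theta> * \<sigma> * B d \<omega>) \<partial>M) = complex_of_real (exp (- ((\<theta> * \<sigma>)\<^sup>2 * d / 2)))"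
    using expectation_iexp_B[OF d, of "\<theta> * \<sigma>"] by simp
  also have "cmod (complex_of_real (exp (- ((\<theta> * \<sigma>)\<^sup>2 * d / 2))) * (\<integral>\<omega>. iexp (\<theta> * U \<omega>) \<partial>M)) \<le> exp (- ((\<theta> * \<sigma>)\<^sup>2 * d / 2)) * 1"
  proof -
    have "cmod (\<integral>\<omega>. iexp (\<theta> * U \<omega>) \<partial>M) \<le> (\<integral>\<omega>. cmod (iexp (\<theta> * U \<omega>)) \<partial>M)" by (rule integral_norm_bound)
    then show ?thesis by (simp add: norm_mult prob_space)
  qed
  finally show ?thesis by (simp add: power_mult_distrib mult_ac)
qed

text \<open>The compensated part Z is given as an L2 limit, without measurability with respect to
  \<open>jump_algebra\<close>. So the bound is applied to truncations, which are functions of N, and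
  passes to the limit.\<close>

lemma norm_char_increment_le:
  assumes d: "0 < d"
  shows "cmod (\<integral>\<omega>. iexp (\<theta> * (X d \<omega> - X 0 \<omega>)) \<partial>M) \<le> exp (- (\<sigma>\<^sup>2 / 2 * \<theta>\<^sup>2 * d))"
proof -
  have [measurable]: "B d \<in> borel_measurable M" "X d \<in> borel_measurable M" "X 0 \<in> borel_measurable M"
    using d by (auto intro: random_variable_B random_variable_X)
  obtain Z where Z: "is_compensated_small_jumps N n d Z"
    and X: "AE \<omega> in M. X d \<omega> = X 0 \<omega> + \<sigma> * B d \<omega> + b * d + large_jumps N d \<omega> + Z \<omega>"
    using levy_ito_decomposition[of d] d by auto
  have [measurable]: "Z \<in> borel_measurable M"
    and lim: "((\<lambda>\<epsilon>. \<integral>\<^sup>+ \<omega>. ennreal ((truncated_small_jumps N n \<epsilon> d \<omega> - Z \<omega>)\<^sup>2) \<partial>M) \<longlongrightarrow> 0) (at_right 0)"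
    using Z by (auto simp: is_compensated_small_jumps_def)
  have [measurable]: "large_jumps N d \<in> borel_measurable M" "truncated_small_jumps N n \<epsilon> d \<in> borel_measurable M" for \<epsilon>
    by (auto intro: measurable_jump_algebra_imp large_jumps_measurable truncated_small_jumps_measurable)
  have approx: "cmod (\<integral>\<omega>. iexp (\<theta> * (X d \<omega> - X 0 \<omega>)) \<partial>M) \<le> exp (- (\<sigma>\<^sup>2 / 2 * \<theta>\<^sup>2 * d)) + 2 * \<bar>\<theta>\<bar> * \<delta>"
    if \<delta>: "0 < \<delta>" for \<delta>
  proof -
    have "\<forall>\<^sub>F \<epsilon> in at_right 0. (\<integral>\<^sup>+ \<omega>. ennreal ((truncated_small_jumps N n \<epsilon> d \<omega> - Z \<omega>)\<^sup>2) \<partial>M) < ennreal (\<delta>\<^sup>2)"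
      using \<delta> by (intro order_tendstoD(2)[OF lim]) simp
    then obtain \<epsilon> where \<epsilon>: "(\<integral>\<^sup>+ \<omega>. ennreal ((truncated_small_jumps N n \<epsilon> d \<omega> - Z \<omega>)\<^sup>2) \<partial>M) < ennreal (\<delta>\<^sup>2)"
      using eventually_happens'[OF trivial_limit_at_right_real] by blast
    define D where "D \<omega> = truncated_small_jumps N n \<epsilon> d \<omega> - Z \<omega>" for \<omega>
    have [measurable]: "D \<in> borel_measurable M" unfolding D_def by measurable
    define U where "U \<omega> = b * d + large_jumps N d \<omega> + truncated_small_jumps N n \<epsilon> d \<omega>" for \<omega>
    have U: "U \<in> borel_measurable jump_algebra"
      unfolding U_def by (intro borel_measurable_add borel_measurable_const large_jumps_measurable truncated_small_jumps_measurable)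
    have [measurable]: "U \<in> borel_measurable M" by (rule measurable_jump_algebra_imp[OF U])
    let ?f = "\<lambda>\<omega>. iexp (\<theta> * (X d \<omega> - X 0 \<omega>))" and ?g = "\<lambda>\<omega>. iexp (\<theta> * (\<sigma> * B d \<omega> + U \<omega>))"
    have int: "integrable M ?f" "integrable M ?g" by (auto intro!: integrable_iexp)
    have "ennreal (cmod ((\<integral>\<omega>. ?f \<omega> \<partial>M) - (\<integral>\<omega>. ?g \<omega> \<partial>M))) = ennreal (cmod (\<integral>\<omega>. ?f \<omega> - ?g \<omega> \<partial>M))"
      using int by simp
    also have "\<dots> \<le> (\<integral>\<^sup>+\<omega>. ennreal (cmod (?f \<omega> - ?g \<omega>)) \<partial>M)"
      using int by (intro integral_norm_bound_ennreal) simp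
    \<comment> \<open>|D| <= \<delta> + D^2/\<delta> takes the place of Cauchy-Schwarz: with E D^2 <
      \<delta>^2 it gives E|D| <= 2 \<delta>.\<close>
    also have "\<dots> \<le> (\<integral>\<^sup>+\<omega>. ennreal \<bar>\<theta>\<bar> * (ennreal \<delta> + ennreal (1 / \<delta>) * ennreal ((D \<omega>)\<^sup>2)) \<partial>M)"
    proof (rule nn_integral_mono_AE)
      show "AE \<omega> in M. ennreal (cmod (?f \<omega> - ?g \<omega>)) \<le> ennreal \<bar>\<theta>\<bar> * (ennreal \<delta> + ennreal (1 / \<delta>) * ennreal ((D \<omega>)\<^sup>2))"
        using X
      proof eventually_elim
        case (elim \<omega>)
        have "cmod (?f \<omega> - ?g \<omega>) \<le> \<bar>\<theta> * (X d \<omega> - X 0 \<omega>) - \<theta> * (\<sigma> * B d \<omega> + U \<omega>)\<bar>"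
          by (rule norm_iexp_diff_le)
        also have "\<theta> * (X d \<omega> - X 0 \<omega>) - \<theta> * (\<sigma> * B d \<omega> + U \<omega>) = - \<theta> * D \<omega>"
          by (simp add: elim U_def D_def algebra_simps)
        also have "\<bar>- \<theta> * D \<omega>\<bar> \<le> \<bar>\<theta>\<bar> * (\<delta> + 1 / \<delta> * (D \<omega>)\<^sup>2)"
        proof -
          have "\<bar>D \<omega>\<bar> \<le> \<delta> + 1 / \<delta> * (D \<omega>)\<^sup>2"
          proof (cases "\<bar>D \<omega>\<bar> \<le> \<delta>")
            case True
            then show ?thesis using \<delta> by (simp add: add_increasing2)
          next
            case False
            then have "\<delta> * \<bar>D \<omega>\<bar> \<le> \<bar>D \<omega>\<bar> * \<bar>D \<omega>\<bar>" by (intro mult_right_mono) auto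
            then have "\<bar>D \<omega>\<bar> \<le> 1 / \<delta> * (D \<omega>)\<^sup>2" using \<delta> by (simp add: field_simps power2_eq_square)
            then show ?thesis using \<delta> by linarith
          qed
          then show ?thesis by (simp add: abs_mult mult_left_mono)
        qed
        finally show ?case
          using \<delta> by (simp add: ennreal_mult[symmetric] ennreal_plus[symmetric] ennreal_leI del: ennreal_plus)
      qed
    qed
    also have "\<dots> = ennreal \<bar>\<theta>\<bar> * (ennreal \<delta> + ennreal (1 / \<delta>) * (\<integral>\<^sup>+\<omega>. ennreal ((D \<omega>)\<^sup>2) \<partial>M))"
      by (simp add: nn_integral_cmult nn_integral_add emeasure_space_1)
    also have "\<dots> \<le> ennreal \<bar>\<theta>\<bar> * (ennreal \<delta> + ennreal (1 / \<delta>) * ennreal (\<delta>\<^sup>2))"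
      using \<epsilon> unfolding D_def by (intro mult_left_mono add_left_mono) auto
    also have "\<dots> = ennreal (2 * \<bar>\<theta>\<bar> * \<delta>)"
      using \<delta> by (simp add: ennreal_mult[symmetric] ennreal_plus[symmetric] power2_eq_square mult_ac del: ennreal_plus)
    finally have "cmod ((\<integral>\<omega>. ?f \<omega> \<partial>M) - (\<integral>\<omega>. ?g \<omega> \<partial>M)) \<le> 2 * \<bar>\<theta>\<bar> * \<delta>"
      using \<delta> by simp
    moreover have "cmod (\<integral>\<omega>. ?g \<omega> \<partial>M) \<le> exp (- (\<sigma>\<^sup>2 / 2 * \<theta>\<^sup>2 * d))"
      by (rule norm_char_B_plus_jumps_le[OF d U])
    ultimately show ?thesis
      using norm_triangle_sub[of "\<integral>\<omega>. ?f \<omega> \<partial>M" "\<integral>\<omega>. ?g \<omega> \<partial>M"] by linarith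
  qed
  show ?thesis
  proof (rule field_le_epsilon)
    fix e :: real assume e: "0 < e"
    \<comment> \<open>The summand 1 keeps this choice of \<delta> positive when \<theta> =
      0.\<close>
    have "2 * \<bar>\<theta>\<bar> * (e / (2 * \<bar>\<theta>\<bar> + 1)) \<le> e" using e by (simp add: field_simps)
    then show "cmod (\<integral>\<omega>. iexp (\<theta> * (X d \<omega> - X 0 \<omega>)) \<partial>M) \<le> exp (- (\<sigma>\<^sup>2 / 2 * \<theta>\<^sup>2 * d)) + e"
      using approx[of "e / (2 * \<bar>\<theta>\<bar> + 1)"] e by (smt (verit) divide_pos_pos)
  qed
qed

lemma future_char_eq_prod:
  "future_char y s Ds = (\<Prod>i<length Ds. iexp (snd (Ds ! i) *
     (y (s + sum_list (map fst (take (Suc i) Ds))) - y (s + sum_list (map fst (take i Ds))))))"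
proof (induction Ds arbitrary: s)
  case (Cons D Ds)
  show ?case
    by (simp add: Cons prod.lessThan_Suc_shift add.assoc del: prod.lessThan_Suc)
qed simp

lemma norm_expectation_future_char_le:
  assumes s: "0 \<le> s" and Ds: "\<And>D. D \<in> set Ds \<Longrightarrow> 0 < fst D"
  shows "cmod (\<integral>\<omega>. future_char (\<lambda>r. X r \<omega>) s Ds \<partial>M) \<le> damping (\<sigma>\<^sup>2 / 2) Ds"
proof -
  \<comment> \<open>The times between the spans; positive spans make them strictly increasing, as
    \<open>independent_increments\<close> asks.\<close>
  define \<tau> where "\<tau> i = s + sum_list (map fst (take i Ds))" for i
  have \<tau>_Suc: "\<tau> (Suc i) = \<tau> i + fst (Ds ! i)" if "i < length Ds" for i
    using that by (simp add: \<tau>_def take_Suc_conv_app_nth)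
  have pos: "0 < fst (Ds ! i)" if "i < length Ds" for i using Ds that by simp
  have \<tau>_mono: "\<tau> i < \<tau> j" if "i < j" "j \<le> length Ds" for i j
    using that
  proof (induction j)
    case (Suc j)
    then show ?case using \<tau>_Suc[of j] pos[of j] by (cases "i = j") auto
  qed simp
  have \<tau>_0: "\<tau> 0 = s" by (simp add: \<tau>_def)
  have \<tau>_nonneg: "0 \<le> \<tau> i" if "i \<le> length Ds" for i
    using \<tau>_mono[of 0 i] that s \<tau>_0 by (cases "i = 0") auto
  have indep: "indep_vars (\<lambda>_. borel) (\<lambda>i \<omega>. X (\<tau> (Suc i)) \<omega> - X (\<tau> i) \<omega>) {..<length Ds}"
  proof -
    have "strict_mono_on {..length Ds} \<tau>" using \<tau>_mono by (auto simp: strict_mono_on_def)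
    then show ?thesis using increments_indep s \<tau>_0 unfolding independent_increments_def by auto
  qed
  have [measurable]: "X (\<tau> i) \<in> borel_measurable M" if "i \<le> length Ds" for i
    using random_variable_X \<tau>_nonneg that by blast
  have "(\<integral>\<omega>. future_char (\<lambda>r. X r \<omega>) s Ds \<partial>M) =
      (\<integral>\<omega>. (\<Prod>i<length Ds. iexp (snd (Ds ! i) * (X (\<tau> (Suc i)) \<omega> - X (\<tau> i) \<omega>))) \<partial>M)"
    by (simp only: future_char_eq_prod \<tau>_def)
  also have "\<dots> = (\<Prod>i<length Ds. (\<integral>\<omega>. iexp (snd (Ds ! i) * (X (\<tau> (Suc i)) \<omega> - X (\<tau> i) \<omega>)) \<partial>M))"
  proof (rule indep_vars_lebesgue_integral)
    show "indep_vars (\<lambda>_. borel) (\<lambda>i \<omega>. iexp (snd (Ds ! i) * (X (\<tau> (Suc i)) \<omega> - X (\<tau> i) \<omega>))) {..<length Ds}"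
      using indep by (rule indep_vars_compose2) auto
    show "integrable M (\<lambda>\<omega>. iexp (snd (Ds ! i) * (X (\<tau> (Suc i)) \<omega> - X (\<tau> i) \<omega>)))" if "i \<in> {..<length Ds}" for i
      using that by (intro integrable_iexp) auto
  qed simp
  also have "cmod \<dots> = (\<Prod>i<length Ds. cmod (\<integral>\<omega>. iexp (snd (Ds ! i) * (X (\<tau> (Suc i)) \<omega> - X (\<tau> i) \<omega>)) \<partial>M))"
    by (rule prod_norm[symmetric])
  also have "\<dots> \<le> (\<Prod>i<length Ds. exp (- (\<sigma>\<^sup>2 / 2 * (snd (Ds ! i))\<^sup>2 * fst (Ds ! i))))"
  proof (rule prod_mono, intro conjI norm_ge_zero)
    fix i assume "i \<in> {..<length Ds}"
    then have i: "i < length Ds" by simp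
    have [measurable]: "X (\<tau> i + fst (Ds ! i)) \<in> borel_measurable M" "X (\<tau> i) \<in> borel_measurable M"
        "X (fst (Ds ! i)) \<in> borel_measurable M" "X 0 \<in> borel_measurable M"
      using i \<tau>_nonneg[of i] pos[OF i] by (auto intro!: random_variable_X)
    have "(\<integral>\<omega>. iexp (snd (Ds ! i) * (X (\<tau> (Suc i)) \<omega> - X (\<tau> i) \<omega>)) \<partial>M) =
        char (distr M borel (\<lambda>\<omega>. X (\<tau> i + fst (Ds ! i)) \<omega> - X (\<tau> i) \<omega>)) (snd (Ds ! i))"
      unfolding char_def \<tau>_Suc[OF i] by (subst integral_distr) auto
    also have "\<dots> = (\<integral>\<omega>. iexp (snd (Ds ! i) * (X (fst (Ds ! i)) \<omega> - X 0 \<omega>)) \<partial>M)"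
      using i \<tau>_nonneg[of i] pos[OF i]
      by (subst increments_stationary) (auto simp: char_def integral_distr)
    finally show "cmod (\<integral>\<omega>. iexp (snd (Ds ! i) * (X (\<tau> (Suc i)) \<omega> - X (\<tau> i) \<omega>)) \<partial>M) \<le>
        exp (- (\<sigma>\<^sup>2 / 2 * (snd (Ds ! i))\<^sup>2 * fst (Ds ! i)))"
      using norm_char_increment_le[OF pos[OF i]] by simp
  qed
  also have "\<dots> = damping (\<sigma>\<^sup>2 / 2) Ds"
    by (induction Ds) (simp_all add: prod.lessThan_Suc_shift del: prod.lessThan_Suc)
  finally show ?thesis .
qed

end

section \<open>Gaussian mollification of the occupation density\<close>

text \<open>Interpolates between the Lipschitz bound at short distance and the trivial bound 2.
  Taken at - u x and - u y, it buys |x - y|^\<gamma> at the price of |u|^\<gamma>.\<close>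

lemma norm_iexp_diff_powr_le:
  assumes "0 < \<gamma>" "\<gamma> \<le> 1"
  shows "cmod (iexp x - iexp y) \<le> 2 * \<bar>x - y\<bar> powr \<gamma>"
proof (cases "\<bar>x - y\<bar> \<le> 1")
  case True
  have "\<bar>x - y\<bar> \<le> \<bar>x - y\<bar> powr \<gamma>"
    using powr_mono'[of \<gamma> 1 "\<bar>x - y\<bar>"] True assms by simp
  moreover have "0 \<le> \<bar>x - y\<bar> powr \<gamma>" by simp
  ultimately show ?thesis using norm_iexp_diff_le[of x y] by linarith
next
  case False
  then have "1 \<le> \<bar>x - y\<bar> powr \<gamma>" using assms by (intro ge_one_powr_ge_zero) auto
  moreover have "cmod (iexp x - iexp y) \<le> 2"
    using norm_triangle_ineq4[of "iexp x" "iexp y"] by simp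
  ultimately show ?thesis by linarith
qed

lemma integrable_std_normal_density_scaled:
  assumes "0 < \<epsilon>"
  shows "integrable lborel (\<lambda>u. std_normal_density (\<epsilon> * u))"
  using lborel_integrable_real_affine[of std_normal_density \<epsilon> 0] integrable_std_normal_moment[of 0] assms by simp

text \<open>Up to scaling the Gaussian is its own Fourier transform: the characteristic function of
  the standard normal law at z/\<epsilon>, after the substitution of \<epsilon> u for the
  integration variable.\<close>

lemma normal_density_fourier:
  assumes \<epsilon>: "0 < \<epsilon>"
  shows "complex_of_real (normal_density 0 \<epsilon> z) =
    (LBINT u. complex_of_real (std_normal_density (\<epsilon> * u) / sqrt (2 * pi)) * iexp (u * z))"
proof -
  have "complex_of_real (exp (- ((z / \<epsilon>)\<^sup>2) / 2)) = char std_normal_distribution (z / \<epsilon>)"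
    by (simp add: char_std_normal_distribution)
  also have "\<dots> = (LBINT x. std_normal_density x *\<^sub>R iexp (z / \<epsilon> * x))"
    unfolding char_def by (subst integral_density) auto
  also have "\<dots> = \<epsilon> *\<^sub>R (LBINT u. std_normal_density (\<epsilon> * u) *\<^sub>R iexp (u * z))"
    using \<epsilon> by (subst lborel_integral_real_affine[where c=\<epsilon> and t=0]) (auto simp: mult.commute)
  finally have *: "complex_of_real (exp (- ((z / \<epsilon>)\<^sup>2) / 2)) = \<epsilon> *\<^sub>R (LBINT u. std_normal_density (\<epsilon> * u) *\<^sub>R iexp (u * z))" .
  have "(LBINT u. complex_of_real (std_normal_density (\<epsilon> * u) / sqrt (2 * pi)) * iexp (u * z)) =
      (LBINT u. complex_of_real (1 / sqrt (2 * pi)) * (std_normal_density (\<epsilon> * u) *\<^sub>R iexp (u * z)))"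
    by (intro Bochner_Integration.integral_cong) (auto simp: scaleR_conv_of_real)
  also have "\<dots> = complex_of_real (1 / sqrt (2 * pi)) * (LBINT u. std_normal_density (\<epsilon> * u) *\<^sub>R iexp (u * z))"
    by (rule integral_mult_right_zero)
  also have "\<dots> = complex_of_real (1 / (\<epsilon> * sqrt (2 * pi))) * complex_of_real (exp (- ((z / \<epsilon>)\<^sup>2) / 2))"
    unfolding * using \<epsilon> by (simp add: scaleR_conv_of_real)
  also have "\<dots> = complex_of_real (normal_density 0 \<epsilon> z)"
    using \<epsilon> by (simp add: normal_density_def real_sqrt_mult power_divide mult_ac)
  finally show ?thesis ..
qed

lemma normal_density_le:
  assumes "0 < \<epsilon>"
  shows "normal_density 0 \<epsilon> z \<le> 1 / sqrt (2 * pi * \<epsilon>\<^sup>2)"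
  using assms unfolding normal_density_def by (intro mult_left_le) auto

text \<open>On the Fourier side \<epsilon> enters through a factor of at most 1, so the bound is
  uniform in it. The sup bound A blows up as \<epsilon> tends to 0, but only secures integrability.
  Even k makes the power nonnegative.\<close>

lemma (in fourier_damped_process) mollified_increment_moment_le:
  assumes \<epsilon>: "0 < \<epsilon>" and \<gamma>: "0 < \<gamma>" "\<gamma> \<le> 1" and t: "0 < t" and k: "0 < k" "even k"
  shows "(\<integral>\<^sup>+\<omega>. ennreal ((LBINT r. indicator {0<..<t} r * (normal_density 0 \<epsilon> (Y r \<omega> - x) - normal_density 0 \<epsilon> (Y r \<omega> - y))) ^ k) \<partial>M) \<le>
    ennreal (fact k) * (ennreal (2 * \<bar>x - y\<bar> powr \<gamma>) * weight_integral \<gamma> * ennreal (2 * max t (1 / c))) ^ k"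
proof -
  define \<alpha> where "\<alpha> z = normal_density 0 \<epsilon> (z - x) - normal_density 0 \<epsilon> (z - y)" for z
  define A where "A = 1 / sqrt (2 * pi * \<epsilon>\<^sup>2)"
  define \<psi> where "\<psi> u = complex_of_real (std_normal_density (\<epsilon> * u) / sqrt (2 * pi)) * (iexp (- u * x) - iexp (- u * y))" for u
  have \<alpha>_meas [measurable]: "\<alpha> \<in> borel_measurable borel" unfolding \<alpha>_def by measurable
  have \<alpha>_bd: "\<bar>\<alpha> z\<bar> \<le> A" for z
    using normal_density_le[OF \<epsilon>, of "z - x"] normal_density_le[OF \<epsilon>, of "z - y"]
      normal_density_nonneg[of 0 \<epsilon> "z - x"] normal_density_nonneg[of 0 \<epsilon> "z - y"]
    unfolding \<alpha>_def A_def by linarith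
  have int: "integrable lborel (\<lambda>u. complex_of_real (std_normal_density (\<epsilon> * u) / sqrt (2 * pi)) * iexp (u * z))" for z
    by (rule Bochner_Integration.integrable_bound[OF integrable_divide[OF integrable_std_normal_density_scaled[OF \<epsilon>], of "sqrt (2 * pi)"]])
      (auto simp: norm_mult norm_divide)
  have \<psi>_eq: "\<psi> u * iexp (u * z) = complex_of_real (std_normal_density (\<epsilon> * u) / sqrt (2 * pi)) * iexp (u * (z - x)) -
      complex_of_real (std_normal_density (\<epsilon> * u) / sqrt (2 * pi)) * iexp (u * (z - y))" for u z
  proof -
    have "iexp (- u * x) * iexp (u * z) = iexp (u * (z - x))" "iexp (- u * y) * iexp (u * z) = iexp (u * (z - y))"
      by (simp_all add: exp_add[symmetric] algebra_simps)
    then show ?thesis by (simp only: \<psi>_def mult.assoc left_diff_distrib right_diff_distrib)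
  qed
  have \<psi>_int: "integrable lborel \<psi>"
  proof -
    have "integrable lborel (\<lambda>u. \<psi> u * iexp (u * 0))"
      unfolding \<psi>_eq by (intro Bochner_Integration.integrable_diff int)
    then show ?thesis by simp
  qed
  have \<alpha>_eq: "complex_of_real (\<alpha> z) = (LBINT u. \<psi> u * iexp (u * z))" for z
    unfolding \<psi>_eq Bochner_Integration.integral_diff[OF int int] \<alpha>_def normal_density_fourier[OF \<epsilon>, symmetric] by simp
  have \<psi>: "cmod (\<psi> u) \<le> 2 * \<bar>x - y\<bar> powr \<gamma> * \<bar>u\<bar> powr \<gamma>" for u
  proof -
    have pi: "1 \<le> sqrt (2 * pi)" using pi_gt3 by simp
    have "std_normal_density (\<epsilon> * u) \<le> 1 / sqrt (2 * pi)" using normal_density_le[of 1] by simp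
    also have "\<dots> \<le> sqrt (2 * pi)" using pi by (simp add: divide_le_eq)
    finally have "std_normal_density (\<epsilon> * u) / sqrt (2 * pi) \<le> 1" using pi by (simp add: divide_le_eq)
    then have "cmod (complex_of_real (std_normal_density (\<epsilon> * u) / sqrt (2 * pi))) \<le> 1"
      by (subst norm_of_real) auto
    then have "cmod (\<psi> u) \<le> 1 * (2 * \<bar>- u * x - (- u * y)\<bar> powr \<gamma>)"
      unfolding \<psi>_def norm_mult by (intro mult_mono norm_iexp_diff_powr_le \<gamma>) auto
    also have "\<bar>- u * x - (- u * y)\<bar> = \<bar>u\<bar> * \<bar>x - y\<bar>"
      by (simp add: abs_mult[symmetric] abs_minus_commute algebra_simps)
    finally show ?thesis by (simp add: powr_mult mult_ac)
  qed
  define W where "W \<omega> = (LBINT r. indicator {0<..<t} r * \<alpha> (Y r \<omega>))" for \<omega>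
  have W_meas [measurable]: "W \<in> borel_measurable M"
    unfolding W_def by (rule lborel.borel_measurable_lebesgue_integral) measurable
  have W_bd: "\<bar>W \<omega>\<bar> \<le> A * t" if "\<omega> \<in> space M" for \<omega>
  proof -
    have "(\<lambda>r. \<alpha> (Y r \<omega>)) \<in> borel_measurable borel" using that by measurable
    then show ?thesis
      using iterated_integral_bound[of "\<lambda>r. \<alpha> (Y r \<omega>)" A t 1] \<alpha>_bd t by (simp add: W_def)
  qed
  have "integrable M (\<lambda>\<omega>. W \<omega> ^ k)"
  proof (rule integrable_const_bound)
    show "AE \<omega> in M. norm (W \<omega> ^ k) \<le> (A * t) ^ k"
      using W_bd by (intro AE_I2) (auto simp: power_abs intro: power_mono)
  qed measurable
  then have "(\<integral>\<^sup>+\<omega>. ennreal (W \<omega> ^ k) \<partial>M) = ennreal (\<integral>\<omega>. W \<omega> ^ k \<partial>M)"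
    using k by (intro nn_integral_eq_integral) (auto simp: zero_le_even_power)
  also have "\<dots> \<le> ennreal \<bar>\<integral>\<omega>. W \<omega> ^ k \<partial>M\<bar>" by (intro ennreal_leI) simp
  also have "\<dots> \<le> ennreal (fact k) * (ennreal (2 * \<bar>x - y\<bar> powr \<gamma>) * weight_integral \<gamma> * ennreal (2 * max t (1 / c))) ^ k"
    unfolding W_def using \<gamma> t k(1)
    by (intro integral_power_moment_le[OF \<alpha>_meas \<alpha>_bd \<psi>_int \<alpha>_eq _ _ _ \<psi>]) auto
  finally show ?thesis by (simp only: W_def \<alpha>_def)
qed

text \<open>The occupation formula, tested with the kernel centred at x, turns the time integral
  into the Gaussian average of f(x + \<epsilon> v) over v; continuity and the bound F then give
  dominated convergence.\<close>

lemma mollified_occupation_density_tendsto: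
  fixes f w :: "real \<Rightarrow> real"
  assumes cont: "continuous_on UNIV f" and nn: "\<And>x. 0 \<le> f x" and F: "\<And>x. f x \<le> F"
    and [measurable]: "w \<in> borel_measurable borel"
    and occ: "\<And>g :: real \<Rightarrow> ennreal. g \<in> borel_measurable borel \<Longrightarrow>
      (\<integral>\<^sup>+ s\<in>{0..t}. g (w s) * ennreal q \<partial>lborel) = (\<integral>\<^sup>+ x. g x * ennreal (f x) \<partial>lborel)"
    and q: "0 \<le> q" and \<epsilon>: "\<epsilon> \<longlonglongrightarrow> 0" "\<And>m. 0 < \<epsilon> m"
  shows "(\<lambda>m. q * (LBINT r. indicator {0<..<t} r * normal_density 0 (\<epsilon> m) (w r - x))) \<longlonglongrightarrow> f x"
proof -
  have [measurable]: "f \<in> borel_measurable borel" using cont by (rule borel_measurable_continuous_onI)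
  have eq: "q * (LBINT r. indicator {0<..<t} r * normal_density 0 (\<epsilon> m) (w r - x)) =
      (LBINT v. std_normal_density v * f (x + \<epsilon> m * v))" for m
  proof -
    define K where "K z = normal_density 0 (\<epsilon> m) (z - x)" for z
    have K_meas [measurable]: "K \<in> borel_measurable borel" unfolding K_def by measurable
    have K_nn: "0 \<le> K z" for z by (simp add: K_def)
    have int_dens: "integrable lborel std_normal_density" using integrable_std_normal_moment[of 0] by simp
    have "ennreal (q * (LBINT r. indicator {0<..<t} r * K (w r))) = (\<integral>\<^sup>+r. ennreal (q * (indicator {0<..<t} r * K (w r))) \<partial>lborel)"
    proof -
      have "integrable lborel (\<lambda>r. indicator {0<..<t} r * K (w r))"
        using normal_density_le[OF \<epsilon>(2), of m] K_nn
        by (intro integrable_indicator_interval_mult[where K="1 / sqrt (2 * pi * (\<epsilon> m)\<^sup>2)"]) (auto simp: K_def)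
      then show ?thesis using q K_nn by (subst nn_integral_eq_integral) auto
    qed
    also have "\<dots> = (\<integral>\<^sup>+ s\<in>{0..t}. ennreal (K (w s)) * ennreal q \<partial>lborel)"
    proof (rule nn_integral_cong_AE)
      show "AE r in lborel. ennreal (q * (indicator {0<..<t} r * K (w r))) = ennreal (K (w r)) * ennreal q * indicator {0..t} r"
        using AE_lborel_singleton[of 0] AE_lborel_singleton[of t]
        by eventually_elim (use q K_nn in \<open>auto simp: indicator_def ennreal_mult[symmetric] mult.commute\<close>)
    qed
    also have "\<dots> = (\<integral>\<^sup>+ z. ennreal (K z) * ennreal (f z) \<partial>lborel)" by (rule occ) measurable
    also have "\<dots> = (\<integral>\<^sup>+ v. ennreal (\<epsilon> m) * (ennreal (K (x + \<epsilon> m * v)) * ennreal (f (x + \<epsilon> m * v))) \<partial>lborel)"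
      using \<epsilon>(2)[of m] by (subst nn_integral_real_affine[where c="\<epsilon> m" and t=x]) (auto simp: nn_integral_cmult)
    also have "\<dots> = (\<integral>\<^sup>+ v. ennreal (std_normal_density v * f (x + \<epsilon> m * v)) \<partial>lborel)"
    proof (intro nn_integral_cong)
      fix v
      have "\<epsilon> m * K (x + \<epsilon> m * v) = std_normal_density v"
        using \<epsilon>(2)[of m] by (simp add: K_def normal_density_def real_sqrt_mult power_mult_distrib)
      then have "ennreal (\<epsilon> m) * ennreal (K (x + \<epsilon> m * v)) = ennreal (std_normal_density v)"
        using \<epsilon>(2)[of m] K_nn by (simp add: ennreal_mult[symmetric])
      then show "ennreal (\<epsilon> m) * (ennreal (K (x + \<epsilon> m * v)) * ennreal (f (x + \<epsilon> m * v))) = ennreal (std_normal_density v * f (x + \<epsilon> m * v))"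
        using nn by (simp add: mult.assoc[symmetric] ennreal_mult)
    qed
    also have "\<dots> = ennreal (LBINT v. std_normal_density v * f (x + \<epsilon> m * v))"
    proof (rule nn_integral_eq_integral)
      show "integrable lborel (\<lambda>v. std_normal_density v * f (x + \<epsilon> m * v))"
        using F nn by (intro Bochner_Integration.integrable_bound[OF integrable_mult_left[OF int_dens, of F]])
          (auto simp: abs_mult intro!: mult_left_mono order.trans[OF _ abs_ge_self])
    qed (auto simp: nn)
    finally show ?thesis
      using q K_nn nn by (subst (asm) ennreal_inj) (auto simp: K_def intro!: integral_nonneg_AE mult_nonneg_nonneg)
  qed
  have "(\<lambda>m. LBINT v. std_normal_density v * f (x + \<epsilon> m * v)) \<longlonglongrightarrow> (LBINT v. std_normal_density v * f x)"
  proof (rule integral_dominated_convergence)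
    show "integrable lborel (\<lambda>v. std_normal_density v * F)"
      using integrable_std_normal_moment[of 0] by simp
    show "AE v in lborel. (\<lambda>m. std_normal_density v * f (x + \<epsilon> m * v)) \<longlonglongrightarrow> std_normal_density v * f x"
    proof (rule AE_I2)
      fix v :: real
      have "(\<lambda>m. x + \<epsilon> m * v) \<longlonglongrightarrow> x + 0 * v" by (intro tendsto_intros \<epsilon>)
      then have "(\<lambda>m. f (x + \<epsilon> m * v)) \<longlonglongrightarrow> f x"
        by (intro continuous_on_tendsto_compose[OF cont]) auto
      then show "(\<lambda>m. std_normal_density v * f (x + \<epsilon> m * v)) \<longlonglongrightarrow> std_normal_density v * f x"
        by (rule tendsto_mult_left)
    qed
    show "AE v in lborel. norm (std_normal_density v * f (x + \<epsilon> m * v)) \<le> std_normal_density v * F" for m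
      using F nn by (auto simp: abs_mult intro!: mult_left_mono)
  qed measurable
  then show ?thesis by (simp add: eq)
qed

section \<open>Measurable versions, dyadic chaining and zeros of densities\<close>

lemma future_char_cong:
  assumes "\<And>r. s \<le> r \<Longrightarrow> y r = z r - a" and "\<And>D. D \<in> set Ds \<Longrightarrow> 0 < fst D"
  shows "future_char y s Ds = future_char z s Ds"
  using assms
proof (induction Ds arbitrary: s)
  case (Cons D Ds)
  have "0 < fst D" using Cons.prems(2) by simp
  moreover have "future_char y (s + fst D) Ds = future_char z (s + fst D) Ds"
  proof (rule Cons.IH)
    fix r assume "s + fst D \<le> r"
    then show "y r = z r - a" using \<open>0 < fst D\<close> by (intro Cons.prems(1)) simp
  qed (use Cons.prems(2) in simp)
  ultimately show ?case using Cons.prems(1)[of s] Cons.prems(1)[of "s + fst D"] by simp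
qed simp

text \<open>Fubini over time and probability needs joint measurability, while only each
  \<open>X t\<close> is known to be measurable. Right-continuity recovers the path from its values
  on countable time grids.\<close>

lemma (in levy_process) ex_measurable_version:
  "\<exists>Y. (\<lambda>(s, \<omega>). Y s \<omega>) \<in> borel_measurable (borel \<Otimes>\<^sub>M M) \<and> (AE \<omega> in M. \<forall>s\<ge>0. Y s \<omega> = X s \<omega> - X 0 \<omega>)"
proof -
  \<comment> \<open>Floor plus one, not the ceiling: the grid time must lie strictly to the right of
    s for the limit in \<open>at_right s\<close>.\<close>
  define \<tau> where "\<tau> m s = (real_of_int \<lfloor>s * (real m + 1)\<rfloor> + 1) / (real m + 1)" for m :: nat and s :: real
  have \<tau>: "s < \<tau> m s" "\<tau> m s \<le> s + 1 / (real m + 1)" for m s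
  proof -
    have "s * (real m + 1) < real_of_int \<lfloor>s * (real m + 1)\<rfloor> + 1" by linarith
    then show "s < \<tau> m s" unfolding \<tau>_def by (subst pos_less_divide_eq) auto
    have "real_of_int \<lfloor>s * (real m + 1)\<rfloor> + 1 \<le> s * (real m + 1) + 1" by linarith
    then have "\<tau> m s \<le> (s * (real m + 1) + 1) / (real m + 1)" unfolding \<tau>_def by (intro divide_right_mono) auto
    also have "\<dots> = s + 1 / (real m + 1)" by (simp add: add_divide_distrib)
    finally show "\<tau> m s \<le> s + 1 / (real m + 1)" .
  qed
  \<comment> \<open>\<open>max 0\<close> keeps the time index in the range where X is known to be
    measurable, also for negative s.\<close>
  define Y where "Y s \<omega> = (if 0 \<le> s then lim (\<lambda>m. X (max 0 (\<tau> m s)) \<omega>) - X 0 \<omega> else 0)" for s \<omega>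
  have [measurable]: "X 0 \<in> borel_measurable M" by (intro random_variable_X) simp
  have [measurable]: "(\<lambda>z. X (max 0 (\<tau> m (fst z))) (snd z)) \<in> borel_measurable (borel \<Otimes>\<^sub>M M)" for m
  proof -
    have "(\<lambda>z. (\<lambda>j z. X (max 0 ((real_of_int j + 1) / (real m + 1))) (snd z)) \<lfloor>fst z * (real m + 1)\<rfloor> z) \<in> borel_measurable (borel \<Otimes>\<^sub>M M)"
    proof (rule measurable_compose_countable[where f="\<lambda>j z. X (max 0 ((real_of_int j + 1) / (real m + 1))) (snd z)" and g="\<lambda>z. \<lfloor>fst z * (real m + 1)\<rfloor>"])
      fix j :: int
      have [measurable]: "X (max 0 ((real_of_int j + 1) / (real m + 1))) \<in> borel_measurable M"
        by (intro random_variable_X) simp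
      show "(\<lambda>z. X (max 0 ((real_of_int j + 1) / (real m + 1))) (snd z)) \<in> borel_measurable (borel \<Otimes>\<^sub>M M)"
        by measurable
    qed measurable
    then show ?thesis by (simp add: \<tau>_def)
  qed
  have "(\<lambda>(s, \<omega>). Y s \<omega>) \<in> borel_measurable (borel \<Otimes>\<^sub>M M)"
    unfolding Y_def case_prod_beta by measurable
  moreover have "AE \<omega> in M. \<forall>s\<ge>0. Y s \<omega> = X s \<omega> - X 0 \<omega>"
    using cadlag_paths
  proof eventually_elim
    case (elim \<omega>)
    show ?case
    proof (intro allI impI)
      fix s :: real assume s: "0 \<le> s"
      have "(\<lambda>m. \<tau> m s) \<longlonglongrightarrow> s"
      proof (rule real_tendsto_sandwich[where f="\<lambda>_. s" and h="\<lambda>m. s + 1 / (real m + 1)"])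
        show "(\<lambda>m. s + 1 / (real m + 1)) \<longlonglongrightarrow> s"
          using tendsto_add[OF tendsto_const[of s] LIMSEQ_inverse_real_of_nat] by (simp add: inverse_eq_divide add_ac)
        show "\<forall>\<^sub>F m in sequentially. s \<le> \<tau> m s"
          using less_imp_le[OF \<tau>(1)] by (auto intro!: always_eventually)
        show "\<forall>\<^sub>F m in sequentially. \<tau> m s \<le> s + 1 / (real m + 1)"
          using \<tau>(2) by (auto intro!: always_eventually)
      qed simp
      moreover have "\<tau> m s \<in> {s<..} \<and> \<tau> m s \<noteq> s" for m using \<tau>(1)[of s m] by simp
      ultimately have "filterlim (\<lambda>m. \<tau> m s) (at_right s) sequentially"
        unfolding filterlim_at by simp
      moreover have "max 0 (\<tau> m s) = \<tau> m s" for m using s \<tau>(1)[of s m] by simp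
      ultimately have "filterlim (\<lambda>m. max 0 (\<tau> m s)) (at_right s) sequentially" by simp
      then have "(\<lambda>m. X (max 0 (\<tau> m s)) \<omega>) \<longlonglongrightarrow> X s \<omega>"
        using elim s unfolding cadlag_def by (auto intro: filterlim_compose)
      then show "Y s \<omega> = X s \<omega> - X 0 \<omega>"
        using s by (simp add: Y_def limI)
    qed
  qed
  ultimately show ?thesis by blast
qed

text \<open>Kolmogorov's argument, with V in the role of a k-th power of an increment: the sum over
  all dyadic levels, weighted by 2^(\<alpha> n), has finite mean and so is almost surely finite; it
  dominates each of its terms.\<close>

lemma dyadic_moment_AE_bound:
  fixes V :: "real \<Rightarrow> real \<Rightarrow> 'a \<Rightarrow> ennreal"
  assumes [measurable]: "\<And>x y. V x y \<in> borel_measurable M"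
    and C: "0 \<le> C" and V: "\<And>x y. (\<integral>\<^sup>+\<omega>. V x y \<omega> \<partial>M) \<le> ennreal (C * \<bar>x - y\<bar> powr \<beta>)" and \<beta>: "\<alpha> + 2 \<le> \<beta>"
  shows "AE \<omega> in M. \<forall>R::nat. \<exists>s\<ge>0. \<forall>n (j::int). \<bar>j\<bar> \<le> int R * 2 ^ n \<longrightarrow>
    V (of_int j / 2 ^ n) ((of_int j + 1) / 2 ^ n) \<omega> * ennreal ((2 powr \<alpha>) ^ n) \<le> ennreal s"
  unfolding AE_all_countable
proof
  fix R :: nat
  define T where "T n \<omega> = (\<Sum>j\<in>{- (int R * 2 ^ n)..int R * 2 ^ n}. V (of_int j / 2 ^ n) ((of_int j + 1) / 2 ^ n) \<omega> * ennreal ((2 powr \<alpha>) ^ n))"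
    for n :: nat and \<omega>
  have [measurable]: "T n \<in> borel_measurable M" for n unfolding T_def by measurable
  \<comment> \<open>At most (2 R + 1) 2^n indices j, each contributing at most C (1/4)^n by the gap
    of 2 between the exponents.\<close>
  define c where "c n = (2 * real R + 1) * C * (1 / 2) ^ n" for n :: nat
  have T_le: "(\<integral>\<^sup>+\<omega>. T n \<omega> \<partial>M) \<le> ennreal (c n)" for n
  proof -
    have "(\<integral>\<^sup>+\<omega>. T n \<omega> \<partial>M) = (\<Sum>j\<in>{- (int R * 2 ^ n)..int R * 2 ^ n}. (\<integral>\<^sup>+\<omega>. V (of_int j / 2 ^ n) ((of_int j + 1) / 2 ^ n) \<omega> \<partial>M) * ennreal ((2 powr \<alpha>) ^ n))"
      unfolding T_def by (simp add: nn_integral_sum nn_integral_multc)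
    also have "\<dots> \<le> (\<Sum>j\<in>{- (int R * 2 ^ n)..int R * 2 ^ n}. ennreal (C * (2 powr (- \<beta>)) ^ n) * ennreal ((2 powr \<alpha>) ^ n))"
    proof (intro sum_mono mult_right_mono)
      fix j :: int
      have "\<bar>real_of_int j / 2 ^ n - (real_of_int j + 1) / 2 ^ n\<bar> powr \<beta> = (2 powr (- \<beta>)) ^ n"
      proof -
        have "\<bar>real_of_int j / 2 ^ n - (real_of_int j + 1) / 2 ^ n\<bar> = 2 powr (- real n)"
          by (simp add: diff_divide_distrib[symmetric] powr_minus powr_realpow inverse_eq_divide)
        then show ?thesis by (simp add: powr_powr powr_power[of 2] mult.commute)
      qed
      then show "(\<integral>\<^sup>+\<omega>. V (of_int j / 2 ^ n) ((of_int j + 1) / 2 ^ n) \<omega> \<partial>M) \<le> ennreal (C * (2 powr (- \<beta>)) ^ n)"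
        using V[of "of_int j / 2 ^ n" "(of_int j + 1) / 2 ^ n"] by simp
    qed simp
    also have "\<dots> = of_nat (card {- (int R * 2 ^ n)..int R * 2 ^ n}) * (ennreal (C * (2 powr (- \<beta>)) ^ n) * ennreal ((2 powr \<alpha>) ^ n))"
      by (rule sum_constant)
    also have "\<dots> = ennreal (real (card {- (int R * 2 ^ n)..int R * 2 ^ n}) * (C * (2 powr (- \<beta>)) ^ n * (2 powr \<alpha>) ^ n))"
      using C by (simp only: ennreal_of_nat_eq_real_of_nat ennreal_mult[symmetric] of_nat_0_le_iff mult_nonneg_nonneg zero_le_power powr_ge_zero)
    also have "\<dots> \<le> ennreal (c n)"
    proof (rule ennreal_leI)
      have "real (card {- (int R * 2 ^ n)..int R * 2 ^ n}) = 2 * (real R * 2 ^ n) + 1"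
        by (simp add: nat_add_distrib nat_mult_distrib nat_power_eq)
      also have "\<dots> \<le> (2 * real R + 1) * 2 ^ n" by (simp add: algebra_simps)
      finally have 1: "real (card {- (int R * 2 ^ n)..int R * 2 ^ n}) \<le> (2 * real R + 1) * 2 ^ n" .
      have "(2 powr (- \<beta>)) ^ n * (2 powr \<alpha>) ^ n = (2 powr (\<alpha> - \<beta>)) ^ n"
        by (simp add: power_mult_distrib[symmetric] powr_add[symmetric])
      also have "\<dots> \<le> (2 powr (- 2)) ^ n" using \<beta> by (intro power_mono powr_mono) auto
      also have "\<dots> = (1 / 4) ^ n" by (simp add: powr_minus)
      finally have 2: "C * (2 powr (- \<beta>)) ^ n * (2 powr \<alpha>) ^ n \<le> C * (1 / 4) ^ n"
        using C by (simp add: mult.assoc mult_left_mono)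
      have "real (card {- (int R * 2 ^ n)..int R * 2 ^ n}) * (C * (2 powr (- \<beta>)) ^ n * (2 powr \<alpha>) ^ n) \<le>
          ((2 * real R + 1) * 2 ^ n) * (C * (1 / 4) ^ n)"
        using C by (intro mult_mono[OF 1 2]) auto
      also have "\<dots> = c n"
      proof -
        have "(2::real) ^ n * (1 / 4) ^ n = (1 / 2) ^ n" by (simp add: power_mult_distrib[symmetric])
        then show ?thesis by (simp add: c_def mult_ac)
      qed
      finally show "real (card {- (int R * 2 ^ n)..int R * 2 ^ n}) * (C * (2 powr (- \<beta>)) ^ n * (2 powr \<alpha>) ^ n) \<le> c n" .
    qed
    finally show ?thesis .
  qed
  have "(\<integral>\<^sup>+\<omega>. (\<Sum>n. T n \<omega>) \<partial>M) = (\<Sum>n. \<integral>\<^sup>+\<omega>. T n \<omega> \<partial>M)"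
    by (rule nn_integral_suminf) measurable
  also have "\<dots> \<le> (\<Sum>n. ennreal (c n))" by (intro suminf_le T_le) auto
  also have "\<dots> < \<infinity>"
  proof -
    have "summable c" unfolding c_def by (intro summable_mult summable_geometric) simp
    then show ?thesis using C by (subst suminf_ennreal2) (auto simp: c_def)
  qed
  finally have "AE \<omega> in M. (\<Sum>n. T n \<omega>) \<noteq> \<infinity>"
    by (intro nn_integral_PInf_AE) auto
  then show "AE \<omega> in M. \<exists>s\<ge>0. \<forall>n (j::int). \<bar>j\<bar> \<le> int R * 2 ^ n \<longrightarrow>
    V (of_int j / 2 ^ n) ((of_int j + 1) / 2 ^ n) \<omega> * ennreal ((2 powr \<alpha>) ^ n) \<le> ennreal s"
  proof eventually_elim
    case (elim \<omega>)
    show ?case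
    proof (intro exI[of _ "enn2real (\<Sum>n. T n \<omega>)"] conjI allI impI)
      fix n :: nat and j :: int assume j: "\<bar>j\<bar> \<le> int R * 2 ^ n"
      have "V (of_int j / 2 ^ n) ((of_int j + 1) / 2 ^ n) \<omega> * ennreal ((2 powr \<alpha>) ^ n) \<le> T n \<omega>"
        unfolding T_def using j
        by (intro member_le_sum[where f="\<lambda>j. V (of_int j / 2 ^ n) ((of_int j + 1) / 2 ^ n) \<omega> * ennreal ((2 powr \<alpha>) ^ n)"]) auto
      also have "\<dots> \<le> (\<Sum>n. T n \<omega>)"
        using sum_le_suminf[of "\<lambda>n. T n \<omega>" "{n}"] by simp
      finally show "V (of_int j / 2 ^ n) ((of_int j + 1) / 2 ^ n) \<omega> * ennreal ((2 powr \<alpha>) ^ n) \<le> ennreal (enn2real (\<Sum>n. T n \<omega>))"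
        using elim by (simp add: less_top)
    qed simp
  qed
qed

text \<open>The part of U where f is positive is open and Lebesgue null, hence empty.\<close>

lemma continuous_zero_of_nn_integral_zero:
  fixes f :: "real \<Rightarrow> real"
  assumes cont: "continuous_on UNIV f" and nn: "\<And>x. 0 \<le> f x" and U: "open U"
    and zero: "(\<integral>\<^sup>+x. indicator U x * ennreal (f x) \<partial>lborel) = 0" and x: "x \<in> U"
  shows "f x = 0"
proof (rule ccontr)
  assume "f x \<noteq> 0"
  then have fx: "0 < f x" using nn[of x] by simp
  have [measurable]: "f \<in> borel_measurable borel" using cont by (rule borel_measurable_continuous_onI)
  have [measurable]: "U \<in> sets borel" using U by simp
  define S where "S = U \<inter> f -` {0<..}"
  have "open S" unfolding S_def using cont U by (intro open_Int open_vimage) auto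
  have "AE z in lborel. indicator U z * ennreal (f z) = 0"
    using zero by (subst (asm) nn_integral_0_iff_AE) auto
  then have "AE z in lborel. z \<notin> S"
    by eventually_elim (auto simp: S_def indicator_def split: if_splits)
  then have "S \<in> null_sets lborel"
    using \<open>open S\<close> by (subst AE_iff_null_sets) auto
  then have "negligible S"
    by (simp add: negligible_iff_null_sets null_sets_completionI)
  then show False
    using \<open>open S\<close> x fx open_not_negligible[of S] by (auto simp: S_def)
qed

section \<open>The local time\<close>

text \<open>Since Y starts at 0, its value at s is the increment over the span from 0 to s. Putting
  (s, \<eta>) in front of the list reduces the claim to the damping of increments of X from time
  0.\<close>

lemma (in levy_ito_process) fourier_damped_version:
  assumes \<sigma>: "\<sigma> \<noteq> 0" and Y [measurable]: "(\<lambda>(s, \<omega>). Y s \<omega>) \<in> borel_measurable (borel \<Otimes>\<^sub>M M)"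
    and eq: "AE \<omega> in M. \<forall>s\<ge>0. Y s \<omega> = X s \<omega> - X 0 \<omega>"
  shows "fourier_damped_process M Y (\<sigma>\<^sup>2 / 2)"
proof unfold_locales
  fix s \<eta> :: real and Ds :: "(real \<times> real) list"
  assume s: "0 < s" and Ds: "\<And>D. D \<in> set Ds \<Longrightarrow> 0 < fst D"
  \<comment> \<open>\<open>future_char_measurable\<close> asks for measurability at every real time;
    cutting at 0 provides it and leaves the times that occur untouched.\<close>
  define X' where "X' r \<omega> = X (max 0 r) \<omega>" for r \<omega>
  have [measurable]: "X' r \<in> borel_measurable M" for r
    unfolding X'_def by (rule random_variable_X) simp
  have Ds': "0 < fst D" if "D \<in> set ((s, \<eta>) # Ds)" for D
  proof -
    have "D = (s, \<eta>) \<or> D \<in> set Ds" using that by simp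
    then show ?thesis using s Ds[of D] by auto
  qed
  have X'_char: "future_char (\<lambda>r. X' r \<omega>) 0 ((s, \<eta>) # Ds) = future_char (\<lambda>r. X r \<omega>) 0 ((s, \<eta>) # Ds)" for \<omega>
    using Ds' by (intro future_char_cong[where a=0]) (auto simp: X'_def)
  have "(\<integral>\<omega>. iexp (\<eta> * Y s \<omega>) * future_char (\<lambda>r. Y r \<omega>) s Ds \<partial>M) = (\<integral>\<omega>. future_char (\<lambda>r. X' r \<omega>) 0 ((s, \<eta>) # Ds) \<partial>M)"
  proof (rule integral_cong_AE)
    show "AE \<omega> in M. iexp (\<eta> * Y s \<omega>) * future_char (\<lambda>r. Y r \<omega>) s Ds = future_char (\<lambda>r. X' r \<omega>) 0 ((s, \<eta>) # Ds)"
      using eq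
    proof eventually_elim
      case (elim \<omega>)
      \<comment> \<open>\<open>future_char\<close> sees only increments, so the shift by the
        starting value is invisible.\<close>
      have "future_char (\<lambda>r. Y r \<omega>) s Ds = future_char (\<lambda>r. X r \<omega>) s Ds"
        using s Ds elim by (intro future_char_cong[where a="X 0 \<omega>"]) auto
      then show ?case unfolding X'_char using elim s by simp
    qed
  qed measurable
  also have "cmod \<dots> \<le> damping (\<sigma>\<^sup>2 / 2) ((s, \<eta>) # Ds)"
    unfolding X'_char using Ds' by (intro norm_expectation_future_char_le) auto
  finally show "cmod (\<integral>\<omega>. iexp (\<eta> * Y s \<omega>) * future_char (\<lambda>r. Y r \<omega>) s Ds \<partial>M) \<le>
      exp (- (\<sigma>\<^sup>2 / 2 * \<eta>\<^sup>2 * s)) * damping (\<sigma>\<^sup>2 / 2) Ds"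
    by simp
qed (use \<sigma> in auto)

text \<open>Fatou. The liminf is defined on every path, so its moments can be bounded before it is
  identified with an increment of the local time.\<close>

lemma (in fourier_damped_process) liminf_increment_moment_le:
  assumes \<gamma>: "0 < \<gamma>" "\<gamma> < 1 / 2" and t: "0 < t" and k: "0 < k" "even k" and \<epsilon>: "\<And>m. 0 < \<epsilon> m"
  obtains C where "0 \<le> C" and "\<And>x y. (\<integral>\<^sup>+\<omega>. liminf (\<lambda>m. ennreal ((LBINT r. indicator {0<..<t} r *
      (normal_density 0 (\<epsilon> m) (Y r \<omega> - x) - normal_density 0 (\<epsilon> m) (Y r \<omega> - y))) ^ k)) \<partial>M) \<le>
    ennreal (C * \<bar>x - y\<bar> powr (\<gamma> * real k))"
proof
  define w where "w = enn2real (weight_integral \<gamma>)"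
  have w: "weight_integral \<gamma> = ennreal w" using weight_integral_finite[OF \<gamma>] by (simp add: w_def)
  define C where "C = fact k * (2 * w * (2 * max t (1 / c))) ^ k"
  have w_nn: "0 \<le> w" by (simp add: w_def)
  show "0 \<le> C" using t w_nn by (simp add: C_def)
  fix x y :: real
  let ?D = "\<lambda>m \<omega>. ennreal ((LBINT r. indicator {0<..<t} r *
      (normal_density 0 (\<epsilon> m) (Y r \<omega> - x) - normal_density 0 (\<epsilon> m) (Y r \<omega> - y))) ^ k)"
  have bound: "(\<integral>\<^sup>+\<omega>. ?D m \<omega> \<partial>M) \<le> ennreal (C * \<bar>x - y\<bar> powr (\<gamma> * real k))" for m
  proof -
    have "(\<integral>\<^sup>+\<omega>. ?D m \<omega> \<partial>M) \<le> ennreal (fact k) * (ennreal (2 * \<bar>x - y\<bar> powr \<gamma>) * weight_integral \<gamma> * ennreal (2 * max t (1 / c))) ^ k"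
      using \<gamma> t k \<epsilon> by (intro mollified_increment_moment_le) auto
    also have "\<dots> = ennreal (fact k * (2 * \<bar>x - y\<bar> powr \<gamma> * w * (2 * max t (1 / c))) ^ k)"
      unfolding w using t w_nn by (simp add: ennreal_mult[symmetric] ennreal_power del: ennreal_fact)
    also have "fact k * (2 * \<bar>x - y\<bar> powr \<gamma> * w * (2 * max t (1 / c))) ^ k = C * (\<bar>x - y\<bar> powr \<gamma>) ^ k"
      unfolding C_def by (simp only: power_mult_distrib mult_ac)
    also have "(\<bar>x - y\<bar> powr \<gamma>) ^ k = \<bar>x - y\<bar> powr (\<gamma> * real k)"
      using k by (cases "x = y") (auto simp: powr_power mult.commute)
    finally show ?thesis .
  qed
  have "(\<integral>\<^sup>+\<omega>. liminf (\<lambda>m. ?D m \<omega>) \<partial>M) \<le> liminf (\<lambda>m. \<integral>\<^sup>+\<omega>. ?D m \<omega> \<partial>M)"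
    by (rule nn_integral_liminf) measurable
  also have "\<dots> \<le> liminf (\<lambda>m. ennreal (C * \<bar>x - y\<bar> powr (\<gamma> * real k)))"
    by (intro Liminf_mono always_eventually allI bound)
  finally show "(\<integral>\<^sup>+\<omega>. liminf (\<lambda>m. ?D m \<omega>) \<partial>M) \<le> ennreal (C * \<bar>x - y\<bar> powr (\<gamma> * real k))"
    by (simp add: Liminf_const)
qed

lemma bounded_p_variation_zero: "0 < p \<Longrightarrow> bounded_p_variation p (\<lambda>_. 0)"
  by (rule bounded_p_variation_of_holder[where K=0 and R=0]) auto

text \<open>\<open>f\<close> is the occupation density of the path \<open>w\<close>, which the moment bounds only see
  through its increments \<open>w - a\<close> from the starting point.\<close>

lemma bounded_p_variation_occupation_density:
  fixes f w :: "real \<Rightarrow> real"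
  assumes p: "2 < p" and cont: "continuous_on UNIV f" and nn: "\<And>x. 0 \<le> f x"
    and w_meas [measurable]: "w \<in> borel_measurable borel"
    and occ: "\<And>g :: real \<Rightarrow> ennreal. g \<in> borel_measurable borel \<Longrightarrow>
      (\<integral>\<^sup>+ s\<in>{0..t}. g (w s) * ennreal q \<partial>lborel) = (\<integral>\<^sup>+ x. g x * ennreal (f x) \<partial>lborel)"
    and q: "0 < q" and w_bd: "\<And>s. 0 \<le> s \<Longrightarrow> s \<le> t \<Longrightarrow> \<bar>w s\<bar> \<le> R"
    and \<epsilon>: "\<epsilon> \<longlonglongrightarrow> 0" "\<And>m. 0 < \<epsilon> m" and k: "0 < k" "even k"
    and dyadic: "\<And>K::nat. \<exists>s\<ge>0. \<forall>n (j::int). \<bar>j\<bar> \<le> int K * 2 ^ n \<longrightarrow>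
      liminf (\<lambda>m. ennreal ((LBINT r. indicator {0<..<t} r *
        (normal_density 0 (\<epsilon> m) (w r - a - of_int j / 2 ^ n) - normal_density 0 (\<epsilon> m) (w r - a - (of_int j + 1) / 2 ^ n))) ^ k)) *
        ennreal ((2 powr (1 / p * real k)) ^ n) \<le> ennreal s"
  shows "bounded_p_variation p f"
proof -
  \<comment> \<open>The path spends no time outside [-R, R], so by the occupation formula the
    density has no mass there.\<close>
  have supp: "f x = 0" if "R < \<bar>x\<bar>" for x
  proof (rule continuous_zero_of_nn_integral_zero[OF cont nn, of "- {- R..R}"])
    have "(\<integral>\<^sup>+x. indicator (- {- R..R}) x * ennreal (f x) \<partial>lborel) = (\<integral>\<^sup>+ s\<in>{0..t}. indicator (- {- R..R}) (w s) * ennreal q \<partial>lborel)"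
      by (rule occ[symmetric]) measurable
    also have "\<dots> = (\<integral>\<^sup>+ s. 0 \<partial>(lborel :: real measure))"
      using w_bd by (intro nn_integral_cong) (fastforce simp: indicator_def abs_le_iff)
    finally show "(\<integral>\<^sup>+x. indicator (- {- R..R}) x * ennreal (f x) \<partial>lborel) = 0" by simp
  qed (use that in auto)
  obtain F where "0 \<le> F" and F: "\<And>x. \<bar>f x\<bar> \<le> F"
    using bounded_of_continuous_compact_support[OF cont supp] by blast
  \<comment> \<open>The density of the increments w - a, whose dyadic levels are the ones controlled
    by \<open>dyadic\<close>.\<close>
  define h where "h x = f (x + a)" for x
  define D where "D m x y = (LBINT r. indicator {0<..<t} r * (normal_density 0 (\<epsilon> m) (w r - a - x) - normal_density 0 (\<epsilon> m) (w r - a - y)))"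
    for m x y
  have D_lim: "(\<lambda>m. D m x y) \<longlonglongrightarrow> (h x - h y) / q" for x y
  proof -
    have lim: "(\<lambda>m. q * (LBINT r. indicator {0<..<t} r * normal_density 0 (\<epsilon> m) (w r - a - z))) \<longlonglongrightarrow> h z" for z
    proof -
      have "f x \<le> F" for x using F[of x] by linarith
      then have "(\<lambda>m. q * (LBINT r. indicator {0<..<t} r * normal_density 0 (\<epsilon> m) (w r - (z + a)))) \<longlonglongrightarrow> f (z + a)"
        using q by (intro mollified_occupation_density_tendsto[OF cont nn _ w_meas occ _ \<epsilon>]) auto
      then show ?thesis by (simp add: h_def algebra_simps)
    qed
    have int: "integrable lborel (\<lambda>r. indicator {0<..<t} r * normal_density 0 (\<epsilon> m) (w r - a - z))" for m z
      using normal_density_le[OF \<epsilon>(2), of m]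
      by (intro integrable_indicator_interval_mult[where K="1 / sqrt (2 * pi * (\<epsilon> m)\<^sup>2)"]) auto
    have "(\<lambda>m. (q * (LBINT r. indicator {0<..<t} r * normal_density 0 (\<epsilon> m) (w r - a - x)) -
        q * (LBINT r. indicator {0<..<t} r * normal_density 0 (\<epsilon> m) (w r - a - y))) / q) \<longlonglongrightarrow> (h x - h y) / q"
      using q by (intro tendsto_intros lim) auto
    moreover have "(q * (LBINT r. indicator {0<..<t} r * normal_density 0 (\<epsilon> m) (w r - a - x)) -
        q * (LBINT r. indicator {0<..<t} r * normal_density 0 (\<epsilon> m) (w r - a - y))) / q = D m x y" for m
      using q unfolding D_def right_diff_distrib[of "indicator _ _"] Bochner_Integration.integral_diff[OF int int]
      by (simp add: right_diff_distrib[symmetric])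
    ultimately show ?thesis by simp
  qed
  \<comment> \<open>On this path the mollified increments converge, so the liminf in the moment
    bound is a power of an increment of h.\<close>
  have liminf_eq: "liminf (\<lambda>m. ennreal (D m x y ^ k)) = ennreal (((h x - h y) / q) ^ k)" for x y
    by (intro lim_imp_Liminf tendsto_ennrealI tendsto_power D_lim) simp
  \<comment> \<open>h vanishes from K on, so a dyadic interval with |j| > K 2^n has both end points
    where h is 0; the remaining ones are covered by \<open>dyadic\<close> for this K.\<close>
  obtain K :: nat where K: "R + \<bar>a\<bar> < real K" using reals_Archimedean2 by blast
  have h_zero: "h x = 0" if "real K \<le> \<bar>x\<bar>" for x
    unfolding h_def using K that by (intro supp) linarith
  obtain s where s: "0 \<le> s" and s_bd: "\<And>n (j::int). \<bar>j\<bar> \<le> int K * 2 ^ n \<Longrightarrow>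
      ennreal (((h (of_int j / 2 ^ n) - h ((of_int j + 1) / 2 ^ n)) / q) ^ k) * ennreal ((2 powr (1 / p * real k)) ^ n) \<le> ennreal s"
    using dyadic[of K] unfolding D_def[symmetric] liminf_eq by blast
  \<comment> \<open>The root undoes the k-th power, and q the normalisation: D converges to the
    increment of h divided by q.\<close>
  define C where "C = q * root k s"
  have C: "0 \<le> C" using q s k by (simp add: C_def)
  have h_inc: "\<bar>h ((of_int j + 1) / 2 ^ n) - h (of_int j / 2 ^ n)\<bar> \<le> C * (2 powr - (1 / p)) ^ n" for n :: nat and j :: int
  proof (cases "\<bar>j\<bar> \<le> int K * 2 ^ n")
    case True
    define \<Delta> where "\<Delta> = h (of_int j / 2 ^ n) - h ((of_int j + 1) / 2 ^ n)"
    have "ennreal ((\<Delta> / q) ^ k * (2 powr (1 / p * real k)) ^ n) \<le> ennreal s"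
      using s_bd[OF True] k by (simp add: ennreal_mult[symmetric] zero_le_even_power \<Delta>_def)
    then have "(\<Delta> / q) ^ k * (2 powr (1 / p * real k)) ^ n \<le> s" using s by simp
    moreover have "(\<Delta> / q) ^ k * (2 powr (1 / p * real k)) ^ n = (\<bar>\<Delta>\<bar> / q * (2 powr (1 / p)) ^ n) ^ k"
    proof -
      have "(\<Delta> / q) ^ k = (\<bar>\<Delta>\<bar> / q) ^ k" using k by (simp add: power_divide power_even_abs)
      moreover have "(2 powr (1 / p * real k)) ^ n = ((2 powr (1 / p)) ^ n) ^ k"
        by (simp add: powr_power mult_ac)
      ultimately show ?thesis by (simp only: power_mult_distrib)
    qed
    ultimately have "(\<bar>\<Delta>\<bar> / q * (2 powr (1 / p)) ^ n) ^ k \<le> root k s ^ k"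
      using s k by (simp add: real_root_pow_pos2)
    then have "\<bar>\<Delta>\<bar> / q * (2 powr (1 / p)) ^ n \<le> root k s"
      using q s k by (subst (asm) power_mono_iff) auto
    then have "\<bar>\<Delta>\<bar> \<le> C * (2 powr - (1 / p)) ^ n"
      using q unfolding C_def powr_minus power_inverse by (simp add: field_simps)
    then show ?thesis by (simp add: \<Delta>_def abs_minus_commute)
  next
    case False
    have out: "real K \<le> \<bar>real_of_int i / 2 ^ n\<bar>" if "int K * 2 ^ n \<le> \<bar>i\<bar>" for i :: int
    proof -
      have "real_of_int (int K * 2 ^ n) \<le> real_of_int \<bar>i\<bar>" using that by (simp only: of_int_le_iff)
      then show ?thesis by (simp add: pos_le_divide_eq)
    qed
    have "h (of_int j / 2 ^ n) = 0" using False by (intro h_zero out) simp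
    moreover have "h (of_int (j + 1) / 2 ^ n) = 0" using False by (intro h_zero out) linarith
    ultimately show ?thesis using C by simp
  qed
  have "continuous_on UNIV h"
    unfolding h_def by (intro continuous_on_compose2[OF cont] continuous_intros) auto
  then obtain H where H: "0 \<le> H" "\<And>x y. \<bar>x - y\<bar> \<le> 1 \<Longrightarrow> \<bar>h x - h y\<bar> \<le> H * \<bar>x - y\<bar> powr (1 / p)"
    using holder_of_dyadic_increments[OF _ _ C h_inc] p by auto
  show ?thesis
  proof (rule bounded_p_variation_of_holder[OF cont H(1)])
    show "\<bar>f x - f y\<bar> \<le> H * \<bar>x - y\<bar> powr (1 / p)" if "\<bar>x - y\<bar> \<le> 1" for x y
      using H(2)[of "x - a" "y - a"] that by (simp add: h_def)
  qed (use p supp in auto)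
qed

theorem theorem2:
  fixes M :: "'a measure"
    and X B :: "real \<Rightarrow> 'a \<Rightarrow> real"
    and \<sigma> b t p :: real
    and n :: "real measure"
    and N :: "'a \<Rightarrow> (real \<times> real) measure"
    and L :: "real \<Rightarrow> real \<Rightarrow> 'a \<Rightarrow> real"
  assumes "levy_ito_process M X \<sigma> b B n N"
    and "prob_space.is_local_time M X \<sigma> L"
    and "\<sigma> \<noteq> 0"
    and "(\<integral>\<^sup>+ y\<in>- {0}. ennreal (min (\<bar>y\<bar> powr (3/2)) 1) \<partial>n) < \<infinity>"
    and "0 \<le> t"
    and "2 < p"
  shows "AE \<omega> in M. bounded_p_variation p (\<lambda>a. L t a \<omega>)"
proof -
  interpret levy_ito_process M X \<sigma> b B n N by fact
  have local_time: "AE \<omega> in M. (\<forall>x. 0 \<le> L t x \<omega>) \<and> continuous_on UNIV (\<lambda>x. L t x \<omega>) \<and>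
      (\<forall>g :: real \<Rightarrow> ennreal. g \<in> borel_measurable borel \<longrightarrow>
        (\<integral>\<^sup>+ s\<in>{0..t}. g (X s \<omega>) * ennreal (\<sigma>\<^sup>2) \<partial>lborel) = (\<integral>\<^sup>+ x. g x * ennreal (L t x \<omega>) \<partial>lborel))"
    using assms unfolding is_local_time_def by blast
  show ?thesis
  proof (cases "t = 0")
    \<comment> \<open>The moment bounds require t > 0; at time 0 the occupation formula gives a
      density of total mass 0.\<close>
    case True
    show ?thesis
      using local_time
    proof eventually_elim
      case (elim \<omega>)
      have "(\<integral>\<^sup>+x. indicator UNIV x * ennreal (L t x \<omega>) \<partial>lborel) = (\<integral>\<^sup>+ s\<in>{0..t}. 1 * ennreal (\<sigma>\<^sup>2) \<partial>lborel)"
        using elim by (auto dest!: spec[of _ "\<lambda>_. 1"])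
      also have "\<dots> = 0" by (simp add: True nn_integral_cmult_indicator)
      finally have "L t x \<omega> = 0" for x
        using elim by (intro continuous_zero_of_nn_integral_zero[of "\<lambda>x. L t x \<omega>" UNIV]) auto
      then show ?case using bounded_p_variation_zero[of p] assms by simp
    qed
  next
    case False
    then have t: "0 < t" using assms by simp
    obtain Y where Y [measurable]: "(\<lambda>(s, \<omega>). Y s \<omega>) \<in> borel_measurable (borel \<Otimes>\<^sub>M M)"
      and YX: "AE \<omega> in M. \<forall>s\<ge>0. Y s \<omega> = X s \<omega> - X 0 \<omega>"
      using ex_measurable_version by blast
    interpret Y: fourier_damped_process M Y "\<sigma>\<^sup>2 / 2"
      using assms(3) Y YX by (rule fourier_damped_version)
    \<comment> \<open>The midpoint of 1/p and 1/2: below 1/2 for the moments, above 1/p to leave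
      room for chaining.\<close>
    define \<gamma> where "\<gamma> = (1 / p + 1 / 2) / 2"
    have p: "0 < 1 / p" "1 / p < 1 / 2" using assms by (auto simp: field_simps)
    have \<gamma>: "0 < \<gamma>" "\<gamma> < 1 / 2" "1 / p < \<gamma>" using p by (simp_all add: \<gamma>_def del: zero_less_divide_1_iff)
    obtain l :: nat where l: "2 / (\<gamma> - 1 / p) < real l" using reals_Archimedean2 by blast
    \<comment> \<open>Even, positive and so large that k (\<gamma> - 1/p) >= 2, the gap that makes
      the dyadic sum converge.\<close>
    define k where "k = 2 * Suc l"
    have k: "0 < k" "even k" by (auto simp: k_def)
    have "2 < real l * (\<gamma> - 1 / p)" using l \<gamma> by (simp add: divide_less_eq)
    also have "\<dots> \<le> real k * (\<gamma> - 1 / p)" using \<gamma> by (intro mult_right_mono) (auto simp: k_def)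
    finally have k_exp: "1 / p * real k + 2 \<le> \<gamma> * real k" by (simp add: algebra_simps)
    define \<epsilon> where "\<epsilon> m = inverse (real (Suc m))" for m
    have \<epsilon>: "\<epsilon> \<longlonglongrightarrow> 0" "\<And>m. 0 < \<epsilon> m"
      unfolding \<epsilon>_def by (rule LIMSEQ_inverse_real_of_nat) simp
    \<comment> \<open>Built from Y alone at deterministic levels; the random shift by X 0 enters
      only after a path is fixed.\<close>
    define V where "V x y \<omega> = liminf (\<lambda>m. ennreal ((LBINT r. indicator {0<..<t} r *
      (normal_density 0 (\<epsilon> m) (Y r \<omega> - x) - normal_density 0 (\<epsilon> m) (Y r \<omega> - y))) ^ k))" for x y \<omega>
    have V_meas: "V x y \<in> borel_measurable M" for x y unfolding V_def by measurable
    obtain C where C: "0 \<le> C" "\<And>x y. (\<integral>\<^sup>+\<omega>. V x y \<omega> \<partial>M) \<le> ennreal (C * \<bar>x - y\<bar> powr (\<gamma> * real k))"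
      unfolding V_def using Y.liminf_increment_moment_le[of \<gamma> t k \<epsilon>, OF \<gamma>(1,2) t k \<epsilon>(2)] by blast
    have dyadic: "AE \<omega> in M. \<forall>K::nat. \<exists>s\<ge>0. \<forall>n (j::int). \<bar>j\<bar> \<le> int K * 2 ^ n \<longrightarrow>
        V (of_int j / 2 ^ n) ((of_int j + 1) / 2 ^ n) \<omega> * ennreal ((2 powr (1 / p * real k)) ^ n) \<le> ennreal s"
      by (rule dyadic_moment_AE_bound[OF V_meas C k_exp])
    show ?thesis
      using local_time YX cadlag_paths dyadic AE_space
    proof eventually_elim
      case (elim \<omega>)
      \<comment> \<open>Adding the starting value back to the measurable version gives a Borel path
        that agrees with X from time 0 on.\<close>
      define w where "w s = Y s \<omega> + X 0 \<omega>" for s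
      have w_meas: "w \<in> borel_measurable borel" unfolding w_def using elim(5) by measurable
      have w_X: "w s = X s \<omega>" if "0 \<le> s" for s using elim(2) that by (simp add: w_def)
      obtain R where R: "\<And>s. 0 \<le> s \<Longrightarrow> s \<le> t \<Longrightarrow> \<bar>X s \<omega>\<bar> \<le> R"
        using cadlag_bounded[OF elim(3) assms(5)] by blast
      show ?case
      proof (rule bounded_p_variation_occupation_density[OF assms(6) _ _ w_meas _ _ _ \<epsilon> k])
        fix g :: "real \<Rightarrow> ennreal" assume g: "g \<in> borel_measurable borel"
        have "(\<integral>\<^sup>+ s\<in>{0..t}. g (w s) * ennreal (\<sigma>\<^sup>2) \<partial>lborel) = (\<integral>\<^sup>+ s\<in>{0..t}. g (X s \<omega>) * ennreal (\<sigma>\<^sup>2) \<partial>lborel)"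
          by (intro nn_integral_cong) (auto simp: w_X indicator_def)
        then show "(\<integral>\<^sup>+ s\<in>{0..t}. g (w s) * ennreal (\<sigma>\<^sup>2) \<partial>lborel) = (\<integral>\<^sup>+ x. g x * ennreal (L t x \<omega>) \<partial>lborel)"
          using elim(1) g by simp
      next
        fix K :: nat
        show "\<exists>s\<ge>0. \<forall>n (j::int). \<bar>j\<bar> \<le> int K * 2 ^ n \<longrightarrow>
          liminf (\<lambda>m. ennreal ((LBINT r. indicator {0<..<t} r *
            (normal_density 0 (\<epsilon> m) (w r - X 0 \<omega> - of_int j / 2 ^ n) - normal_density 0 (\<epsilon> m) (w r - X 0 \<omega> - (of_int j + 1) / 2 ^ n))) ^ k)) *
            ennreal ((2 powr (1 / p * real k)) ^ n) \<le> ennreal s"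
          using elim(4) by (simp add: V_def w_def)
      qed (use elim(1) assms(3) R w_X in auto)
    qed
  qed
qed

end
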